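(* Let $X$ be a time-homogeneous Markov process in $\mathbb{R}^d$ and let $T>0$ be such that condition $\mathbf{X}$ (stated in the context) holds with some $B_{T,X}\ge 1$, $\beta\ge 1$ and $q$. Then for every $p>0$, every bounded measurable $h:\mathbb{R}^d\to\mathbb{R}$, every $x\in\mathbb{R}^d$ and every integer $n\ge 1$, $$\left(\mathbb{E}_x\big|I_T(h)-I_{T,n}(h)\big|^p\right)^{1/p}\le C_{T,p}\,\|h\|\,\big(D_{T,\beta}(n)\big)^{1/2},$$ where $\|h\|=\sup_x|h(x)|$, $$D_{T,\beta}(n)=\begin{cases} n^{-1}\log n, & \beta=1,\\ \max\left(1,\frac{T^{1-\beta}}{\beta-1}\right)n^{-1/\beta}, & \beta>1,\end{cases}\qquad C_{T,p}=\begin{cases}(14p(p-1)B_{T,X})^{1/2}\,T, & p\ge 2,\\ C_{T,2}=(28B_{T,X})^{1/2}\,T, & p\in(0,2).\end{cases}$$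
   Context: $X=(X_t)_{t\ge0}$ is a Markov process with values in $\mathbb{R}^d$ with transition probabilities $P_t(x,dy)$; $\mathbb{E}_x$ is expectation given $X_0=x$. The process is understood to be measurable in $(t,\omega)$, so that the integrals below are well defined. For bounded measurable $h:\mathbb{R}^d\to\mathbb{R}$, $$I_T(h)=\int_0^T h(X_t)\,dt,\qquad I_{T,n}(h)=\frac{T}{n}\sum_{k=0}^{n-1}h(X_{kT/n}),\quad n\ge1.$$ Condition $\mathbf{X}$ (for the given $T>0$): for $t>0$ the transition probability $P_t(x,dy)$ admits a density $p_t(x,y)$ with respect to Lebesgue measure on $\mathbb{R}^d$; this density is differentiable in $t$, and $$|\partial_t p_t(x,y)|\le B_{T,X}\,t^{-\beta}q_{t,x}(y),\qquad 0<t\le T,\ x,y\in\mathbb{R}^d,$$ for some constants $B_{T,X}\ge1$, $\beta\ge1$ and some measurable function $q$ such that for each fixed $t,x$ the function $q_{t,x}(\cdot)$ is a probability density on $\mathbb{R}^d$.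
   Formalization: The case β = 1, n = 1 is excluded: there D_{T,1}(1) = 0, and the bound fails, e.g. for one-dimensional Brownian motion started at x = 0 with h the indicator of (0,∞), where I_{T,1}(h) = 0 but E_0 I_T(h) = T/2. *)

theory Defs
  imports "HOL-Probability.Probability"
begin

definition transition_function :: "(real \<Rightarrow> 'a::euclidean_space \<Rightarrow> 'a measure) \<Rightarrow> bool" where
  "transition_function P \<longleftrightarrow>
     (\<forall>t\<ge>0. P t \<in> borel \<rightarrow>\<^sub>M prob_algebra borel) \<and>
     (\<forall>x. P 0 x = return borel x) \<and>
     (\<forall>s\<ge>0. \<forall>t\<ge>0. \<forall>x. P (s + t) x = P s x \<bind> P t)"

definition natural_filtration ::
    "'w measure \<Rightarrow> (real \<Rightarrow> 'w \<Rightarrow> 'a::euclidean_space) \<Rightarrow> real \<Rightarrow> 'w measure" where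
  "natural_filtration M X s =
     sigma (space M) {X u -` A \<inter> space M | u A. 0 \<le> u \<and> u \<le> s \<and> A \<in> sets borel}"

(* F carries only the sigma-algebra on the sample space; Pr x is the law under which the
   process starts at x, so expectation under Pr x is E_x.  Only the values X t with t >= 0
   matter, and X is jointly measurable on [0,oo) x Omega. *)
definition markov_process ::
    "'w measure \<Rightarrow> ('a::euclidean_space \<Rightarrow> 'w measure) \<Rightarrow> (real \<Rightarrow> 'w \<Rightarrow> 'a)
     \<Rightarrow> (real \<Rightarrow> 'a \<Rightarrow> 'a measure) \<Rightarrow> bool" where
  "markov_process F Pr X P \<longleftrightarrow>
     transition_function P \<and>
     (\<lambda>(t, \<omega>). X t \<omega>) \<in> borel_measurable (restrict_space borel {0..} \<Otimes>\<^sub>M F) \<and>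
     (\<forall>x. prob_space (Pr x) \<and> sets (Pr x) = sets F \<and>
          (AE \<omega> in Pr x. X 0 \<omega> = x) \<and>
          (\<forall>s\<ge>0. \<forall>t\<ge>0. \<forall>A\<in>sets borel. AE \<omega> in Pr x.
             real_cond_exp (Pr x) (natural_filtration (Pr x) X s)
               (\<lambda>\<omega>. indicator A (X (s + t) \<omega>)) \<omega>
             = measure (P t (X s \<omega>)) A))"

definition condition_X ::
    "real \<Rightarrow> (real \<Rightarrow> 'a::euclidean_space \<Rightarrow> 'a measure) \<Rightarrow> real \<Rightarrow> real
     \<Rightarrow> (real \<Rightarrow> 'a \<Rightarrow> 'a \<Rightarrow> real) \<Rightarrow> bool" where
  "condition_X T P B \<beta> q \<longleftrightarrow>
     B \<ge> 1 \<and> \<beta> \<ge> 1 \<and>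
     (\<lambda>(t, x, y). q t x y)
        \<in> borel_measurable (restrict_space borel {0<..T} \<Otimes>\<^sub>M borel \<Otimes>\<^sub>M borel) \<and>
     (\<forall>t\<in>{0<..T}. \<forall>x. (\<forall>y. 0 \<le> q t x y) \<and> (\<integral>\<^sup>+ y. ennreal (q t x y) \<partial>lborel) = 1) \<and>
     (\<exists>d :: real \<Rightarrow> 'a \<Rightarrow> 'a \<Rightarrow> real.
        (\<forall>t>0. \<forall>x. d t x \<in> borel_measurable borel \<and> (\<forall>y. 0 \<le> d t x y) \<and>
                   P t x = density lborel (\<lambda>y. ennreal (d t x y))) \<and>
        (\<forall>t>0. \<forall>x y. (\<lambda>s. d s x y) differentiable (at t)) \<and>
        (\<forall>t\<in>{0<..T}. \<forall>x y.
            \<bar>deriv (\<lambda>s. d s x y) t\<bar> \<le> B * t powr (- \<beta>) * q t x y))"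

definition I_int :: "(real \<Rightarrow> 'w \<Rightarrow> 'a::euclidean_space) \<Rightarrow> real \<Rightarrow> ('a \<Rightarrow> real) \<Rightarrow> 'w \<Rightarrow> real" where
  "I_int X T h \<omega> = (LINT t:{0..T}|lborel. h (X t \<omega>))"

definition I_sum ::
    "(real \<Rightarrow> 'w \<Rightarrow> 'a::euclidean_space) \<Rightarrow> real \<Rightarrow> nat \<Rightarrow> ('a \<Rightarrow> real) \<Rightarrow> 'w \<Rightarrow> real" where
  "I_sum X T n h \<omega> = T / real n * (\<Sum>k<n. h (X (real k * T / real n) \<omega>))"

definition sup_norm :: "('a \<Rightarrow> real) \<Rightarrow> real" where
  "sup_norm h = (SUP x. \<bar>h x\<bar>)"

(* D_const T 1 1 = 0, although I_int and I_sum need not agree for n = 1. *)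
definition D_const :: "real \<Rightarrow> real \<Rightarrow> nat \<Rightarrow> real" where
  "D_const T \<beta> n =
     (if \<beta> = 1 then ln (real n) / real n
      else max 1 (T powr (1 - \<beta>) / (\<beta> - 1)) * real n powr (- 1 / \<beta>))"

definition C_const :: "real \<Rightarrow> real \<Rightarrow> real \<Rightarrow> real" where
  "C_const T B p =
     (if p \<ge> 2 then sqrt (14 * p * (p - 1) * B) * T else sqrt (28 * B) * T)"

end

theory Submission
  imports Defs
begin

text \<open>Write $J_t$ for the integral up to time $t$ of $\Delta_r = h(X_r) - h(X_{\eta(r)})$, where $\eta(r)$ is
  the last grid point before $r$. Then $J$ is Lipschitz with constant $2 \|h\|$, and, given the past up to $s$,
  the increment $J_t - J_s$ has conditional mean at most some $L$: for $r - s$ below a window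
  $\epsilon + T/n$ one bounds $\Delta_r$ by $2 \|h\|$, and beyond it the Markov property and condition X bound the
  conditional mean of $\Delta_r$ by $\|h\| B (T/n) (r - s - T/n)^{-\beta}$.

  For $p \ge 2$ put $g(y) = p \, y |y|^{p-2}$. Along a fine grid, convexity of $|y|^p$ and summation by parts
  bound $|J_t|^p$ by the sum of $(g(J_{t_{k+1}}) - g(J_{t_k})) (J_t - J_{t_k})$, whose expectation is
  at most about $L$ times the sum of the $E |g(J_{t_{k+1}}) - g(J_{t_k})|$. Refining the grid gives
  $E |J_t|^p \le 2 p (p-1) \|h\| L T M^{(p-2)/p}$ with $M = \sup_t E |J_t|^p$, hence
  $M^{2/p} \le 2 p (p-1) \|h\| L T$. Smaller $p$ follow from $p = 2$ by concavity.\<close>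

section \<open>Powers and moments\<close>

text \<open>The error J is small only in conditional mean; its increments themselves are merely
  Lipschitz. Summation by parts lets each factor use one of these facts: the increment of g over one
  cell is controlled by the Lipschitz constant and the second derivative of |y|^p, which is where p
  (p-1) comes from, and the remaining path contributes only L. The argument is indifferent to
  whether p is an integer, unlike an expansion of the p-th power into iterated time integrals. Its
  price is a moment of order p - 2 on the right; the supremum over all end times closes the
  inequality, and it is finite because J is bounded.

  The window is forced by the singularity: (r - s)^(-\<beta>) is not integrable at r = s when
  \<beta> \<ge> 1. It is longer than \<epsilon> by T/n because \<eta>(r) may precede r by almost T/n
  and must still lie beyond s. Its choice yields L \<le> 7 ||h|| B T D with D the value of
  \<open>D_const\<close>, and the Lipschitz constant 2 ||h|| turns 7 into 14.\<close>

lemma powr_tangent: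
  fixes x y r :: real
  assumes "r \<ge> 1" "x \<ge> 0" "y \<ge> 0"
  shows "y powr r - x powr r \<le> r * y powr (r - 1) * (y - x)"
proof (cases "r = 1 \<or> y = 0")
  case True
  then show ?thesis using assms by auto
next
  case False
  then have r: "r > 1" and y: "y > 0" using assms by auto
  have q: "r / (r - 1) > 1" "1 / r + 1 / (r / (r - 1)) = 1"
    using r by (auto simp: field_simps)
  \<comment> \<open>Young's inequality with the conjugate exponents r and r / (r - 1). Multiplied by
    r it is the tangent inequality at y; no derivative is taken, so x = 0 is no exception.\<close>
  have "x * y powr (r - 1) \<le> x powr r / r + (y powr (r - 1)) powr (r / (r - 1)) / (r / (r - 1))"
    by (rule Youngs_inequality) (use r q assms in auto)
  also have "(y powr (r - 1)) powr (r / (r - 1)) = y powr r"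
    using r by (simp add: powr_powr)
  finally have "r * (x * y powr (r - 1)) \<le> r * (x powr r / r + y powr r / (r / (r - 1)))"
    using r by (intro mult_left_mono) auto
  also have "\<dots> = x powr r + (r - 1) * y powr r"
    using r by (simp add: field_simps)
  finally have "r * x * y powr (r - 1) \<le> x powr r + (r - 1) * y powr r" by (simp add: mult.assoc)
  moreover have "y powr (r - 1) * y = y powr r"
    using y by (simp add: powr_mult_base[of y "r - 1", simplified] mult.commute)
  ultimately show ?thesis by (simp add: algebra_simps)
qed

text \<open>The odd continuation of the power to negative arguments; \<open>p * spow (p - 1)\<close>
  is the function g of the overview, the derivative of |y|^p.\<close>

definition spow :: "real \<Rightarrow> real \<Rightarrow> real" where
  "spow r x = sgn x * \<bar>x\<bar> powr r"

lemma mono_spow: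
  assumes "0 \<le> r"
  shows "mono (spow r)"
proof (rule monoI)
  fix x y :: real assume xy: "x \<le> y"
  consider "0 \<le> x" | "y \<le> 0" | "x < 0" "0 < y" by linarith
  then show "spow r x \<le> spow r y"
  proof cases
    case 1
    then have "x powr r \<le> y powr r" using assms xy by (intro powr_mono2) auto
    with 1 xy show ?thesis by (auto simp: spow_def sgn_if)
  next
    case 2
    then have "(- y) powr r \<le> (- x) powr r" using assms xy by (intro powr_mono2) auto
    with 2 xy show ?thesis by (auto simp: spow_def sgn_if)
  next
    case 3
    then have "spow r x \<le> 0" "0 \<le> spow r y" by (auto simp: spow_def)
    then show ?thesis by linarith
  qed
qed

text \<open>Convexity: an upper bound for the rise from a to b needs the slope at the end b. Along a
  grid this evaluates g at the end of each cell.\<close>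

lemma abs_powr_diff_le:
  assumes "p \<ge> 1"
  shows "\<bar>b\<bar> powr p - \<bar>a\<bar> powr p \<le> p * spow (p - 1) b * (b - a)"
proof -
  have "\<bar>b\<bar> powr p - \<bar>a\<bar> powr p \<le> p * \<bar>b\<bar> powr (p - 1) * (\<bar>b\<bar> - \<bar>a\<bar>)"
    by (rule powr_tangent) (use assms in auto)
  also have "\<dots> \<le> p * \<bar>b\<bar> powr (p - 1) * (sgn b * (b - a))"
    using assms by (intro mult_left_mono) (auto simp: sgn_if)
  also have "\<dots> = p * spow (p - 1) b * (b - a)"
    by (simp add: spow_def)
  finally show ?thesis .
qed

text \<open>A mean value inequality without derivatives. For equal signs it is
  \<open>powr_tangent\<close> at the point of larger modulus. For opposite signs the difference
  becomes a sum of powers, and z^r \<le> z m^(r-1), with m the larger modulus, bounds each of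
  them.\<close>

lemma spow_diff_le:
  assumes "r \<ge> 1"
  shows "\<bar>spow r b - spow r a\<bar> \<le> r * \<bar>b - a\<bar> * max \<bar>a\<bar> \<bar>b\<bar> powr (r - 1)"
proof -
  have nn: "\<bar>y powr r - x powr r\<bar> \<le> r * \<bar>y - x\<bar> * max x y powr (r - 1)"
    if "0 \<le> x" "0 \<le> y" for x y
  proof (cases "x \<le> y")
    case True
    then have "x powr r \<le> y powr r" using that assms by (intro powr_mono2) auto
    then show ?thesis using powr_tangent[of r x y] that True assms
      by (simp add: max_def algebra_simps)
  next
    case False
    then have "y powr r \<le> x powr r" using that assms by (intro powr_mono2) auto
    then show ?thesis using powr_tangent[of r y x] that False assms
      by (simp add: max_def algebra_simps)
  qed
  have op: "x powr r + y powr r \<le> r * (x + y) * max x y powr (r - 1)" if "0 \<le> x" "0 \<le> y" for x y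
  proof -
    have *: "z powr r \<le> z * max x y powr (r - 1)" if "0 \<le> z" "z \<le> max x y" for z
    proof (cases "z = 0")
      case False
      then have "z powr r = z * z powr (r - 1)"
        using that by (simp add: powr_mult_base)
      also have "\<dots> \<le> z * max x y powr (r - 1)"
        using that assms by (intro mult_left_mono powr_mono2) auto
      finally show ?thesis .
    qed auto
    have "x powr r + y powr r \<le> 1 * ((x + y) * max x y powr (r - 1))"
      using *[of x] *[of y] that by (simp add: distrib_right)
    also have "\<dots> \<le> r * ((x + y) * max x y powr (r - 1))"
      using assms that by (intro mult_right_mono) auto
    finally show ?thesis by (simp add: mult.assoc)
  qed
  consider "a \<ge> 0" "b \<ge> 0" | "a \<le> 0" "b \<le> 0" | "a > 0" "b < 0" | "a < 0" "b > 0" by linarith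
  then show ?thesis
  proof cases
    case 1
    then show ?thesis using nn[of a b] by (auto simp: spow_def sgn_if)
  next
    case 2
    then show ?thesis using nn[of "-a" "-b"] by (auto simp: spow_def sgn_if abs_minus_commute)
  next
    case 3
    have "\<bar>spow r b - spow r a\<bar> = a powr r + (- b) powr r"
      using 3 powr_ge_zero[of a r] powr_ge_zero[of "-b" r] by (simp add: spow_def del: powr_ge_zero)
    then show ?thesis using op[of a "-b"] 3 by simp
  next
    case 4
    have "spow r b - spow r a = (- a) powr r + b powr r" using 4 by (simp add: spow_def)
    then show ?thesis using op[of "-a" b] 4 by (simp add: add.commute)
  qed
qed

section \<open>Jensen's inequality for powers and the moment bound\<close>

context prob_space
begin

text \<open>Jensen for a concave power: the linear part of the tangent at the mean integrates to 0.
  It is applied with exponent (p-2)/p inside the moment bound and with p/2 to reduce p < 2 to the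
  second moment.\<close>

lemma expectation_powr_le:
  fixes Y :: "'a \<Rightarrow> real"
  assumes int: "integrable M Y" "integrable M (\<lambda>\<omega>. Y \<omega> powr \<theta>)"
    and nn: "\<And>\<omega>. Y \<omega> \<ge> 0" and \<theta>: "0 \<le> \<theta>" "\<theta> \<le> 1"
  shows "expectation (\<lambda>\<omega>. Y \<omega> powr \<theta>) \<le> expectation Y powr \<theta>"
proof (cases "expectation Y = 0")
  \<comment> \<open>The tangent at 0 may be vertical, so mean 0 is treated apart. The convention
    \<open>0 powr 0 = 0\<close> makes this case correct for exponent 0 too, which occurs when p =
    2.\<close>
  case True
  then have "AE \<omega> in M. Y \<omega> = 0"
    using integral_nonneg_eq_0_iff_AE[of M Y] int nn by auto
  then have "expectation (\<lambda>\<omega>. Y \<omega> powr \<theta>) = expectation (\<lambda>\<omega>. 0)"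
    using int by (intro integral_cong_AE) auto
  then show ?thesis by simp
next
  case False
  define m where "m = expectation Y"
  have m: "m > 0" using False nn by (simp add: m_def order.not_eq_order_implies_strict)
  have tang: "y powr \<theta> \<le> m powr \<theta> + \<theta> * m powr (\<theta> - 1) * (y - m)" if "y \<ge> 0" for y
  proof (cases "y = 0")
    case True
    have "\<theta> * m powr (\<theta> - 1) * m = \<theta> * m powr \<theta>"
      using m by (simp add: powr_diff)
    also have "\<dots> \<le> 1 * m powr \<theta>" using \<theta> by (intro mult_right_mono) auto
    finally show ?thesis using True by simp
  next
    case False
    with that have y: "y > 0" by simp
    \<comment> \<open>Weighted arithmetic-geometric mean inequality; divided by m^(1-\<theta>) it is
      the tangent inequality at m.\<close>
    have "y powr \<theta> * m powr (1 - \<theta>) \<le> \<theta> * y + (1 - \<theta>) * m"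
      by (rule Youngs_inequality_0) (use \<theta> y m in auto)
    then have "y powr \<theta> * m powr (1 - \<theta>) * m powr (\<theta> - 1) \<le> (\<theta> * y + (1 - \<theta>) * m) * m powr (\<theta> - 1)"
      by (intro mult_right_mono) auto
    also have "y powr \<theta> * m powr (1 - \<theta>) * m powr (\<theta> - 1) = y powr \<theta>"
      using m by (simp add: mult.assoc flip: powr_add)
    also have "(\<theta> * y + (1 - \<theta>) * m) * m powr (\<theta> - 1) = m powr \<theta> + \<theta> * m powr (\<theta> - 1) * (y - m)"
      using m by (simp add: powr_diff field_simps)
    finally show ?thesis .
  qed
  have "expectation (\<lambda>\<omega>. Y \<omega> powr \<theta>) \<le> expectation (\<lambda>\<omega>. m powr \<theta> + \<theta> * m powr (\<theta> - 1) * (Y \<omega> - m))"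
    using int nn by (intro integral_mono tang) auto
  also have "\<dots> = m powr \<theta>"
    using int by (simp add: m_def prob_space)
  finally show ?thesis by (simp add: m_def)
qed


text \<open>No Markov process is left here. The small conditional mean enters through
  \<open>fut\<close>, tested only against differences f(J s) - f(J r), since the weights of the
  summation by parts have this form. Restricting to monotone f ensures that f(J s) is measurable and
  bounded when \<open>fut\<close> has to be proved.\<close>

lemma moment_bound:
  fixes J :: "real \<Rightarrow> 'a \<Rightarrow> real" and c L T p :: real
  assumes meas: "\<And>t. 0 \<le> t \<Longrightarrow> t \<le> T \<Longrightarrow> J t \<in> borel_measurable M"
    and J0: "\<And>\<omega>. J 0 \<omega> = 0"
    and Lip: "\<And>s t \<omega>. 0 \<le> s \<Longrightarrow> s \<le> t \<Longrightarrow> t \<le> T \<Longrightarrow> \<omega> \<in> space M \<Longrightarrow> \<bar>J t \<omega> - J s \<omega>\<bar> \<le> c * (t - s)"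
    and fut: "\<And>f r s t. mono f \<Longrightarrow> 0 \<le> r \<Longrightarrow> r \<le> s \<Longrightarrow> s \<le> t \<Longrightarrow> t \<le> T \<Longrightarrow>
      \<bar>expectation (\<lambda>\<omega>. (f (J s \<omega>) - f (J r \<omega>)) * (J t \<omega> - J s \<omega>))\<bar>
        \<le> L * expectation (\<lambda>\<omega>. \<bar>f (J s \<omega>) - f (J r \<omega>)\<bar>)"
    and p: "p \<ge> 2" and T: "T > 0" and c: "c > 0" and L: "L \<ge> 0"
  shows "expectation (\<lambda>\<omega>. \<bar>J T \<omega>\<bar> powr p) \<le> (p * (p - 1) * c * L * T) powr (p / 2)"
proof -
  define g where "g = (\<lambda>x. p * spow (p - 1) x)"
  have mono_g: "mono g"
    using mono_spow[of "p - 1"] p by (auto simp: g_def mono_def)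
  have [measurable]: "g \<in> borel_measurable borel"
    by (rule borel_measurable_mono[OF mono_g])
  have bd: "\<bar>J t \<omega>\<bar> \<le> c * T" if "0 \<le> t" "t \<le> T" "\<omega> \<in> space M" for t \<omega>
  proof -
    have "\<bar>J t \<omega>\<bar> \<le> c * t" using Lip[of 0 t \<omega>] J0 that by simp
    also have "\<dots> \<le> c * T" using that c by simp
    finally show ?thesis .
  qed
  have g_bd: "\<bar>g (J t \<omega>)\<bar> \<le> p * (c * T) powr (p - 1)" if "0 \<le> t" "t \<le> T" "\<omega> \<in> space M" for t \<omega>
  proof -
    have "\<bar>g (J t \<omega>)\<bar> \<le> p * \<bar>J t \<omega>\<bar> powr (p - 1)"
      using p by (auto simp: g_def spow_def abs_mult sgn_if)
    also have "\<dots> \<le> p * (c * T) powr (p - 1)"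
      using p bd[OF that] by (intro mult_left_mono powr_mono2) auto
    finally show ?thesis .
  qed
  have int: "integrable M (\<lambda>\<omega>. \<bar>J t \<omega>\<bar> powr p)" if "0 \<le> t" "t \<le> T" for t
    using meas[OF that] bd[OF that] p
    by (intro integrable_const_bound[where B = "(c * T) powr p"] AE_I2) (auto intro!: powr_mono2)
  define f where "f t = expectation (\<lambda>\<omega>. \<bar>J t \<omega>\<bar> powr p)" for t
  have f_le: "f t \<le> (c * T) powr p" if "0 \<le> t" "t \<le> T" for t
    unfolding f_def using int[OF that] bd[OF that] p
    by (intro integral_le_const AE_I2) (auto intro!: powr_mono2)
  \<comment> \<open>The supremum over all end times, not the moment at T: the bound for one end time
    S involves the moments at all earlier grid times.\<close>
  define m where "m = (SUP t\<in>{0..T}. f t)"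
  have bdd: "bdd_above (f ` {0..T})"
    by (rule bdd_aboveI[of _ "(c * T) powr p"]) (use f_le in auto)
  have f_le_m: "f t \<le> m" if "0 \<le> t" "t \<le> T" for t
    unfolding m_def using that bdd by (intro cSUP_upper) auto
  have f0: "0 \<le> f t" for t by (simp add: f_def)
  have m0: "0 \<le> m" using f_le_m[of 0] f0[of 0] T by linarith
  \<comment> \<open>A bound for the slope of y^p on [0, 2 c T], a range that contains |J| + e for
    every cell bound e used below. It measures the cost of replacing |J| by |J| + e in the p-th
    moment.\<close>
  define C where "C = p * (2 * c * T) powr (p - 1)"
  have C0: "0 \<le> C" using p by (simp add: C_def)

  \<comment> \<open>The estimate on a grid of N cells in [0, S]. Every term with
    \<open>c * S / real N\<close> is a discretization error that vanishes as N grows.\<close>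
  have step: "f S \<le> (L + c * S / real N) * (p * (p - 1) * (c * S)) * (m + C * (c * S / real N)) powr ((p - 2) / p)"
    if S: "0 < S" "S \<le> T" and N: "N > 0" for S N
  proof -
    define e where "e = c * S / real N"
    have e: "0 < e" "e \<le> c * T"
    proof -
      show "0 < e" using c S N by (simp add: e_def)
      have "e \<le> c * S / 1" unfolding e_def using N c S by (intro divide_left_mono) auto
      also have "\<dots> \<le> c * T" using S c by simp
      finally show "e \<le> c * T" .
    qed
    define t where "t k = real k * S / real N" for k
    have t: "0 \<le> t k" "k \<le> N \<Longrightarrow> t k \<le> T" "t k \<le> t (Suc k)" "j \<le> k \<Longrightarrow> t j \<le> t k" for j k
    proof -
      show "0 \<le> t k" "t k \<le> t (Suc k)" using S by (auto simp: t_def divide_right_mono)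
      show "j \<le> k \<Longrightarrow> t j \<le> t k" using S by (auto simp: t_def intro!: divide_right_mono mult_right_mono)
      assume "k \<le> N"
      then have "t k \<le> real N * S / real N" unfolding t_def
        using S by (intro divide_right_mono mult_right_mono) auto
      then show "t k \<le> T" using S N by simp
    qed
    define a where "a k = J (t k)" for k
    have [measurable]: "a k \<in> borel_measurable M" if "k \<le> N" for k
      using meas t that by (auto simp: a_def)
    have a0: "a 0 \<omega> = 0" for \<omega> using J0 by (simp add: a_def t_def)
    have aN: "a N = J S" using N by (simp add: a_def t_def)
    have inc: "\<bar>a (Suc k) \<omega> - a k \<omega>\<bar> \<le> e" if "k < N" "\<omega> \<in> space M" for k \<omega>
    proof -
      have "\<bar>a (Suc k) \<omega> - a k \<omega>\<bar> \<le> c * (t (Suc k) - t k)"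
        unfolding a_def using that t by (intro Lip) auto
      also have "\<dots> = e" by (simp add: t_def e_def distrib_left distrib_right add_divide_distrib right_diff_distrib mult_ac)
      finally show ?thesis .
    qed
    define d where "d k \<omega> = g (a (Suc k) \<omega>) - g (a k \<omega>)" for k \<omega>
    have d_meas[measurable]: "d k \<in> borel_measurable M" if "k < N" for k
    proof -
      have [measurable]: "a k \<in> borel_measurable M" "a (Suc k) \<in> borel_measurable M" using that by simp_all
      show ?thesis unfolding d_def[abs_def] by measurable
    qed
    have d_bd: "\<bar>d k \<omega>\<bar> \<le> 2 * (p * (c * T) powr (p - 1))" if "k < N" "\<omega> \<in> space M" for k \<omega>
      using g_bd[of "t k" \<omega>] g_bd[of "t (Suc k)" \<omega>] t that unfolding d_def a_def by force
    have d_int: "integrable M (d k)" if "k < N" for k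
      using d_bd that by (intro integrable_const_bound[where B = "2 * (p * (c * T) powr (p - 1))"] AE_I2) auto
    have da_int: "integrable M (\<lambda>\<omega>. d k \<omega> * (a i \<omega> - a j \<omega>))" if "k < N" "i \<le> N" "j \<le> N" for k i j
    proof (rule integrable_const_bound[where B = "2 * (p * (c * T) powr (p - 1)) * (2 * (c * T))"], rule AE_I2)
      fix \<omega> assume \<omega>: "\<omega> \<in> space M"
      have "\<bar>a i \<omega> - a j \<omega>\<bar> \<le> 2 * (c * T)"
        using bd[of "t i" \<omega>] bd[of "t j" \<omega>] t that \<omega> unfolding a_def by force
      then show "norm (d k \<omega> * (a i \<omega> - a j \<omega>)) \<le> 2 * (p * (c * T) powr (p - 1)) * (2 * (c * T))"
        unfolding real_norm_def abs_mult using d_bd[OF that(1) \<omega>] by (intro mult_mono) auto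
    next
      show "(\<lambda>\<omega>. d k \<omega> * (a i \<omega> - a j \<omega>)) \<in> borel_measurable M"
        using d_meas that by measurable
    qed
    \<comment> \<open>Abel summation in inductive form: g(0) = 0 makes g(a n) the sum of all earlier
      d k, so the new product g(a (Suc n)) (a (Suc n) - a n) prolongs the increment of every old
      term and adds the diagonal one.\<close>
    have tele: "\<bar>a n \<omega>\<bar> powr p \<le> (\<Sum>k<n. d k \<omega> * (a n \<omega> - a k \<omega>))" for n \<omega>
    proof (induction n)
      case 0
      then show ?case by (simp add: a0)
    next
      case (Suc n)
      have g0: "g 0 = 0" by (simp add: g_def spow_def)
      have sum_d: "(\<Sum>k<n. d k \<omega>) = g (a n \<omega>)" for n
        by (induction n) (auto simp: d_def a0 g0)
      have "\<bar>a (Suc n) \<omega>\<bar> powr p \<le> \<bar>a n \<omega>\<bar> powr p + g (a (Suc n) \<omega>) * (a (Suc n) \<omega> - a n \<omega>)"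
        using abs_powr_diff_le[of p "a (Suc n) \<omega>" "a n \<omega>"] p by (simp add: g_def)
      also have "\<dots> \<le> (\<Sum>k<n. d k \<omega> * (a n \<omega> - a k \<omega>)) + (\<Sum>k<Suc n. d k \<omega>) * (a (Suc n) \<omega> - a n \<omega>)"
        unfolding sum_d using Suc by simp
      also have "\<dots> = (\<Sum>k<n. d k \<omega> * (a n \<omega> - a k \<omega>) + d k \<omega> * (a (Suc n) \<omega> - a n \<omega>))
          + d n \<omega> * (a (Suc n) \<omega> - a n \<omega>)"
        by (simp add: sum.distrib sum_distrib_right distrib_right)
      also have "\<dots> = (\<Sum>k<Suc n. d k \<omega> * (a (Suc n) \<omega> - a k \<omega>))"
        by (simp add: algebra_simps)
      finally show ?case .
    qed
    \<comment> \<open>The weight d k is known only at the end of cell k, while the increment a N - a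
      k starts at its beginning. \<open>fut\<close> covers the part after the cell; the overlap is
      at most e and is estimated by its absolute value.\<close>
    have term_le: "expectation (\<lambda>\<omega>. d k \<omega> * (a N \<omega> - a k \<omega>)) \<le> (L + e) * expectation (\<lambda>\<omega>. \<bar>d k \<omega>\<bar>)"
      if k: "k < N" for k
    proof -
      have "expectation (\<lambda>\<omega>. d k \<omega> * (a N \<omega> - a k \<omega>))
          = expectation (\<lambda>\<omega>. d k \<omega> * (a N \<omega> - a (Suc k) \<omega>) + d k \<omega> * (a (Suc k) \<omega> - a k \<omega>))"
        by (intro Bochner_Integration.integral_cong) (auto simp: algebra_simps)
      also have "\<dots> = expectation (\<lambda>\<omega>. d k \<omega> * (a N \<omega> - a (Suc k) \<omega>)) + expectation (\<lambda>\<omega>. d k \<omega> * (a (Suc k) \<omega> - a k \<omega>))"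
        using da_int k by (intro Bochner_Integration.integral_add) auto
      also have "expectation (\<lambda>\<omega>. d k \<omega> * (a N \<omega> - a (Suc k) \<omega>)) \<le> L * expectation (\<lambda>\<omega>. \<bar>d k \<omega>\<bar>)"
      proof -
        have "\<bar>expectation (\<lambda>\<omega>. d k \<omega> * (a N \<omega> - a (Suc k) \<omega>))\<bar> \<le> L * expectation (\<lambda>\<omega>. \<bar>d k \<omega>\<bar>)"
          unfolding d_def a_def using t k by (intro fut mono_g) auto
        then show ?thesis by linarith
      qed
      also have "expectation (\<lambda>\<omega>. d k \<omega> * (a (Suc k) \<omega> - a k \<omega>)) \<le> expectation (\<lambda>\<omega>. e * \<bar>d k \<omega>\<bar>)"
      proof (rule integral_mono)
        fix \<omega> assume \<omega>: "\<omega> \<in> space M"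
        have "d k \<omega> * (a (Suc k) \<omega> - a k \<omega>) \<le> \<bar>d k \<omega>\<bar> * \<bar>a (Suc k) \<omega> - a k \<omega>\<bar>"
          by (metis abs_ge_self abs_mult)
        also have "\<dots> \<le> \<bar>d k \<omega>\<bar> * e" using inc[OF k \<omega>] by (intro mult_left_mono) auto
        finally show "d k \<omega> * (a (Suc k) \<omega> - a k \<omega>) \<le> e * \<bar>d k \<omega>\<bar>" by (simp add: mult.commute)
      qed (use da_int d_int k in auto)
      finally show ?thesis by (simp add: distrib_right)
    qed
    \<comment> \<open>One cell moves a by at most e, so both end values have modulus at most |a k| +
      e. Jensen then trades the moment of order p - 2 for the power (p-2)/p of the p-th
      moment.\<close>
    have d_le: "expectation (\<lambda>\<omega>. \<bar>d k \<omega>\<bar>) \<le> p * (p - 1) * e * (m + C * e) powr ((p - 2) / p)"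
      if k: "k < N" for k
    proof -
      let ?Y = "\<lambda>\<omega>. (\<bar>a k \<omega>\<bar> + e) powr p"
      have [measurable]: "a k \<in> borel_measurable M" using k by simp
      have abd: "\<bar>a k \<omega>\<bar> \<le> c * T" if "\<omega> \<in> space M" for \<omega>
        using bd[of "t k" \<omega>] t k that by (auto simp: a_def)
      have Yint: "integrable M (\<lambda>\<omega>. (\<bar>a k \<omega>\<bar> + e) powr r)" if "r \<ge> 0" for r
      proof (rule integrable_const_bound[where B = "(2 * (c * T)) powr r"], rule AE_I2)
        fix \<omega> assume "\<omega> \<in> space M"
        then show "norm ((\<bar>a k \<omega>\<bar> + e) powr r) \<le> (2 * (c * T)) powr r"
          using abd[of \<omega>] e that by (auto intro!: powr_mono2)
      qed measurable
      have YY: "?Y \<omega> powr ((p - 2) / p) = (\<bar>a k \<omega>\<bar> + e) powr (p - 2)" for \<omega>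
        using p by (simp add: powr_powr)
      have "expectation (\<lambda>\<omega>. \<bar>d k \<omega>\<bar>) \<le> expectation (\<lambda>\<omega>. p * (p - 1) * e * (\<bar>a k \<omega>\<bar> + e) powr (p - 2))"
      proof (rule integral_mono)
        fix \<omega> assume \<omega>: "\<omega> \<in> space M"
        have "\<bar>d k \<omega>\<bar> = p * \<bar>spow (p - 1) (a (Suc k) \<omega>) - spow (p - 1) (a k \<omega>)\<bar>"
          using p by (simp add: d_def g_def abs_mult flip: right_diff_distrib)
        also have "\<dots> \<le> p * ((p - 1) * \<bar>a (Suc k) \<omega> - a k \<omega>\<bar> * max \<bar>a k \<omega>\<bar> \<bar>a (Suc k) \<omega>\<bar> powr (p - 1 - 1))"
          using p by (intro mult_left_mono spow_diff_le) auto
        also have "\<dots> \<le> p * ((p - 1) * e * (\<bar>a k \<omega>\<bar> + e) powr (p - 2))"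
          using p e inc[OF k \<omega>] by (intro mult_left_mono mult_mono) (auto intro!: powr_mono2)
        finally show "\<bar>d k \<omega>\<bar> \<le> p * (p - 1) * e * (\<bar>a k \<omega>\<bar> + e) powr (p - 2)"
          by (simp add: mult.assoc)
      qed (use d_int k Yint[of "p - 2"] p in auto)
      also have "\<dots> = p * (p - 1) * e * expectation (\<lambda>\<omega>. ?Y \<omega> powr ((p - 2) / p))"
        unfolding YY by simp
      also have "\<dots> \<le> p * (p - 1) * e * expectation ?Y powr ((p - 2) / p)"
      proof (intro mult_left_mono expectation_powr_le)
        show "integrable M ?Y" using Yint[of p] p by auto
        show "integrable M (\<lambda>\<omega>. ?Y \<omega> powr ((p - 2) / p))" unfolding YY using Yint[of "p - 2"] p by auto
      qed (use p e in auto)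
      also have "\<dots> \<le> p * (p - 1) * e * (m + C * e) powr ((p - 2) / p)"
      proof -
        have "expectation ?Y \<le> expectation (\<lambda>\<omega>. \<bar>a k \<omega>\<bar> powr p + C * e)"
        proof (rule integral_mono)
          show "integrable M ?Y" using Yint[of p] p by auto
          show "integrable M (\<lambda>\<omega>. \<bar>a k \<omega>\<bar> powr p + C * e)" unfolding a_def using t k int by auto
          fix \<omega> assume \<omega>: "\<omega> \<in> space M"
          have "?Y \<omega> - \<bar>a k \<omega>\<bar> powr p \<le> p * (\<bar>a k \<omega>\<bar> + e) powr (p - 1) * (\<bar>a k \<omega>\<bar> + e - \<bar>a k \<omega>\<bar>)"
            using p e by (intro powr_tangent) auto
          also have "\<dots> \<le> C * e"
            unfolding C_def using p e abd[OF \<omega>] by (auto intro!: powr_mono2)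
          finally show "?Y \<omega> \<le> \<bar>a k \<omega>\<bar> powr p + C * e" by simp
        qed
        also have "\<dots> = f (t k) + C * e" using t k int[of "t k"] by (simp add: a_def f_def prob_space)
        also have "\<dots> \<le> m + C * e" using f_le_m[of "t k"] t k by simp
        finally show ?thesis using p e by (intro mult_left_mono powr_mono2) auto
      qed
      finally show ?thesis .
    qed
    have "f S \<le> expectation (\<lambda>\<omega>. \<Sum>k<N. d k \<omega> * (a N \<omega> - a k \<omega>))"
      unfolding f_def aN[symmetric] using tele[of N] da_int S int[of S]
      by (intro integral_mono Bochner_Integration.integrable_sum) (auto simp flip: aN)
    also have "\<dots> = (\<Sum>k<N. expectation (\<lambda>\<omega>. d k \<omega> * (a N \<omega> - a k \<omega>)))"
      using da_int by (intro Bochner_Integration.integral_sum) auto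
    also have "\<dots> \<le> (\<Sum>k<N. (L + e) * (p * (p - 1) * e * (m + C * e) powr ((p - 2) / p)))"
    proof (rule sum_mono)
      fix k assume "k \<in> {..<N}"
      then have k: "k < N" by simp
      have "(L + e) * expectation (\<lambda>\<omega>. \<bar>d k \<omega>\<bar>) \<le> (L + e) * (p * (p - 1) * e * (m + C * e) powr ((p - 2) / p))"
        using L e d_le[OF k] by (intro mult_left_mono) auto
      with term_le[OF k] show "expectation (\<lambda>\<omega>. d k \<omega> * (a N \<omega> - a k \<omega>)) \<le>
          (L + e) * (p * (p - 1) * e * (m + C * e) powr ((p - 2) / p))" by linarith
    qed
    also have "\<dots> = (L + e) * (p * (p - 1) * (real N * e)) * (m + C * e) powr ((p - 2) / p)"
      by simp
    also have "real N * e = c * S" using N by (simp add: e_def)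
    finally show ?thesis by (simp add: e_def)
  qed

  define K where "K = p * (p - 1) * c * L * T"
  have K0: "0 \<le> K" using p c L T by (simp add: K_def)
  have "m \<le> K powr (p / 2)"
  proof (cases "m = 0")
    \<comment> \<open>Positivity of m is used twice: the power is continuous there, so the limit in
      N may be taken, and a power of m can be cancelled afterwards.\<close>
    case False
    with m0 have m: "m > 0" by simp
    have fS: "f S \<le> K * m powr ((p - 2) / p)" if S: "0 \<le> S" "S \<le> T" for S
    proof (cases "S = 0")
      case True
      then show ?thesis using K0 m p by (simp add: f_def J0)
    next
      case False
      with S have S0: "0 < S" by simp
      have lim0: "(\<lambda>N. c * S / real N) \<longlonglongrightarrow> 0"
        by (rule lim_const_over_n)
      have "(\<lambda>N. (L + c * S / real N) * (p * (p - 1) * (c * S)) * (m + C * (c * S / real N)) powr ((p - 2) / p))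
          \<longlonglongrightarrow> (L + 0) * (p * (p - 1) * (c * S)) * (m + C * 0) powr ((p - 2) / p)"
        using m by (intro tendsto_intros lim0) auto
      then have "f S \<le> (L + 0) * (p * (p - 1) * (c * S)) * (m + C * 0) powr ((p - 2) / p)"
        by (rule LIMSEQ_le_const) (use step[OF S0 S(2)] in \<open>auto intro!: exI[of _ 1]\<close>)
      also have "\<dots> \<le> K * m powr ((p - 2) / p)"
      proof -
        have "L * (p * (p - 1) * (c * S)) \<le> L * (p * (p - 1) * (c * T))"
          using L p c S by (intro mult_left_mono) auto
        then have "L * (p * (p - 1) * (c * S)) * m powr ((p - 2) / p) \<le> L * (p * (p - 1) * (c * T)) * m powr ((p - 2) / p)"
          by (intro mult_right_mono) auto
        then show ?thesis by (simp add: K_def mult_ac)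
      qed
      finally show ?thesis .
    qed
    have "m \<le> K * m powr ((p - 2) / p)"
      unfolding m_def using T fS unfolding m_def by (intro cSUP_least) auto
    \<comment> \<open>The supremum stands on both sides. Cancelling m^((p-2)/p) leaves m^(2/p) \<le>
      K, and p/2 is the inverse exponent.\<close>
    then have "m * m powr (- ((p - 2) / p)) \<le> K * m powr ((p - 2) / p) * m powr (- ((p - 2) / p))"
      by (intro mult_right_mono) auto
    also have "\<dots> = K" using m by (simp add: mult.assoc flip: powr_add)
    also have "m * m powr (- ((p - 2) / p)) = m powr (1 + - ((p - 2) / p))"
      using m by (simp only: powr_add) simp
    also have "1 + - ((p - 2) / p) = 2 / p" using p by (simp add: field_simps)
    finally have "(m powr (2 / p)) powr (p / 2) \<le> K powr (p / 2)"
      using p by (intro powr_mono2) auto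
    then show ?thesis using m p by (simp add: powr_powr)
  qed auto
  with f_le_m[of T] T have "f T \<le> K powr (p / 2)" by simp
  then show ?thesis by (simp add: f_def K_def)
qed

end

section \<open>Transition kernels\<close>

lemma integrable_mult_bounded:
  fixes Z w :: "'a \<Rightarrow> real"
  assumes "integrable M Z" "w \<in> borel_measurable M" "\<And>\<omega>. \<omega> \<in> space M \<Longrightarrow> \<bar>w \<omega>\<bar> \<le> C"
  shows "integrable M (\<lambda>\<omega>. Z \<omega> * w \<omega>)"
proof (rule Bochner_Integration.integrable_bound)
  show "integrable M (\<lambda>\<omega>. C * Z \<omega>)" using assms by simp
  show "AE \<omega> in M. norm (Z \<omega> * w \<omega>) \<le> norm (C * Z \<omega>)"
  proof (rule AE_I2)
    fix \<omega> assume "\<omega> \<in> space M"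
    then have "\<bar>w \<omega>\<bar> \<le> \<bar>C\<bar>" using assms(3)[of \<omega>] by simp
    then show "norm (Z \<omega> * w \<omega>) \<le> norm (C * Z \<omega>)"
      by (simp add: abs_mult mult.commute[of "\<bar>C\<bar>"] mult_left_mono)
  qed
qed (use assms in measurable)

lemma prob_kernel:
  assumes "K \<in> borel \<rightarrow>\<^sub>M prob_algebra borel"
  shows "prob_space (K y)" "sets (K y) = sets borel" "space (K y) = UNIV"
proof -
  have "K y \<in> space (prob_algebra borel)" by (rule measurable_space[OF assms]) auto
  then show "prob_space (K y)" "sets (K y) = sets borel" by (auto simp: space_prob_algebra)
  then show "space (K y) = UNIV" using sets_eq_imp_space_eq[of "K y" borel] by simp
qed

lemma prob_kernel_bounded:
  fixes f :: "'b::topological_space \<Rightarrow> real"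
  assumes K: "K \<in> borel \<rightarrow>\<^sub>M prob_algebra borel" and f: "f \<in> borel_measurable borel" "\<And>z. \<bar>f z\<bar> \<le> C"
  shows "integrable (K y) f" "\<bar>\<integral>z. f z \<partial>K y\<bar> \<le> C" "(\<lambda>y. \<integral>z. f z \<partial>K y) \<in> borel_measurable borel"
proof -
  interpret K: prob_space "K y" by (rule prob_kernel[OF K])
  have "f \<in> borel_measurable (K y)" by (subst measurable_cong_sets[OF prob_kernel(2)[OF K] refl]) fact
  then show int: "integrable (K y) f" using f by (intro K.integrable_const_bound[where B = C]) auto
  have "\<bar>\<integral>z. f z \<partial>K y\<bar> \<le> (\<integral>z. \<bar>f z\<bar> \<partial>K y)" by (rule integral_abs_bound)
  also have "\<dots> \<le> C" using int f by (intro K.integral_le_const) auto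
  finally show "\<bar>\<integral>z. f z \<partial>K y\<bar> \<le> C" .
  show "(\<lambda>y. \<integral>z. f z \<partial>K y) \<in> borel_measurable borel"
    by (rule measurable_compose[OF measurable_prob_algebraD[OF K] integral_measurable_subprob_algebra[OF f(1)]])
qed

text \<open>The Markov property speaks of indicators only; approximation by simple functions carries
  it over to bounded functions. As Z may change sign, the limits are taken by domination with C |Z|,
  not by monotone convergence.\<close>

lemma (in prob_space) kernel_expectation_nonneg:
  fixes Z :: "'a \<Rightarrow> real" and U V :: "'a \<Rightarrow> 'b::topological_space" and h :: "'b \<Rightarrow> real"
  assumes Z: "integrable M Z"
    and [measurable]: "U \<in> borel_measurable M" "V \<in> borel_measurable M"
    and K: "K \<in> borel \<rightarrow>\<^sub>M prob_algebra borel"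
    and base: "\<And>A. A \<in> sets borel \<Longrightarrow>
      expectation (\<lambda>\<omega>. Z \<omega> * indicator A (V \<omega>)) = expectation (\<lambda>\<omega>. Z \<omega> * measure (K (U \<omega>)) A)"
    and h: "h \<in> borel_measurable borel" "\<And>y. 0 \<le> h y" "\<And>y. h y \<le> C"
  shows "expectation (\<lambda>\<omega>. Z \<omega> * h (V \<omega>)) = expectation (\<lambda>\<omega>. Z \<omega> * (\<integral>y. h y \<partial>K (U \<omega>)))"
proof -
  note Kp = prob_kernel[OF K]
  note K_int = prob_kernel_bounded(1)[OF K]
  note K_bd = prob_kernel_bounded(2)[OF K]
  have K_meas[measurable]: "(\<lambda>\<omega>. \<integral>z. f z \<partial>K (U \<omega>)) \<in> borel_measurable M"
    if "f \<in> borel_measurable borel" "\<And>z. \<bar>f z\<bar> \<le> C" for f :: "'b \<Rightarrow> real" and C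
    by (rule measurable_compose[OF assms(2) prob_kernel_bounded(3)[OF K that]])
  \<comment> \<open>The bound is quantified inside the predicate because the parts of a function in
    the induction come with bounds of their own.\<close>
  let ?P = "\<lambda>u. \<forall>C. (\<forall>y. u y \<le> C) \<longrightarrow>
    expectation (\<lambda>\<omega>. Z \<omega> * u (V \<omega>)) = expectation (\<lambda>\<omega>. Z \<omega> * (\<integral>y. u y \<partial>K (U \<omega>)))"
  have "?P h"
    using h(1,2)
  proof (induction rule: borel_measurable_induct_real)
    case (set A)
    then show ?case using base[of A] Kp by simp
  next
    case (mult u c)
    show ?case
    \<comment> \<open>If c = 0, a bound on c u says nothing about u and the induction hypothesis
      cannot be used; both sides are then 0.\<close>
    proof (cases "c = 0")
      case False
      with mult have c: "c > 0" by simp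
      show ?thesis
      proof (intro allI impI)
        fix C assume "\<forall>y. c * u y \<le> C"
        then have "\<forall>y. u y \<le> C / c" using c by (simp add: field_simps)
        then have "expectation (\<lambda>\<omega>. Z \<omega> * u (V \<omega>)) = expectation (\<lambda>\<omega>. Z \<omega> * (\<integral>y. u y \<partial>K (U \<omega>)))"
          using mult.IH by blast
        then show "expectation (\<lambda>\<omega>. Z \<omega> * (c * u (V \<omega>))) = expectation (\<lambda>\<omega>. Z \<omega> * (\<integral>y. c * u y \<partial>K (U \<omega>)))"
          by (simp add: mult.left_commute[of _ c])
      qed
    qed simp
  next
    case (add u v)
    note [measurable] = add.hyps(1,3)
    show ?case
    proof (intro allI impI)
      fix C assume C: "\<forall>y. v y + u y \<le> C"
      have ub: "\<bar>u y\<bar> \<le> C" "\<bar>v y\<bar> \<le> C" for y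
        using C[rule_format, of y] add.hyps(2)[of y] add.hyps(4)[of y] by auto
      then have ub': "u y \<le> C" "v y \<le> C" for y by (auto simp: abs_le_iff)
      have "expectation (\<lambda>\<omega>. Z \<omega> * (v (V \<omega>) + u (V \<omega>)))
          = expectation (\<lambda>\<omega>. Z \<omega> * v (V \<omega>)) + expectation (\<lambda>\<omega>. Z \<omega> * u (V \<omega>))"
        unfolding distrib_left
        by (intro Bochner_Integration.integral_add integrable_mult_bounded[OF Z, where C = C] ub) measurable
      also have "\<dots> = expectation (\<lambda>\<omega>. Z \<omega> * (\<integral>y. v y \<partial>K (U \<omega>))) + expectation (\<lambda>\<omega>. Z \<omega> * (\<integral>y. u y \<partial>K (U \<omega>)))"
        using add.IH[rule_format, of C] ub' by simp
      also have "\<dots> = expectation (\<lambda>\<omega>. Z \<omega> * (\<integral>y. v y \<partial>K (U \<omega>)) + Z \<omega> * (\<integral>y. u y \<partial>K (U \<omega>)))"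
        by (intro Bochner_Integration.integral_add[symmetric] integrable_mult_bounded[OF Z, where C = C] K_bd ub K_meas)
          (use ub in auto)
      also have "\<dots> = expectation (\<lambda>\<omega>. Z \<omega> * (\<integral>y. v y + u y \<partial>K (U \<omega>)))"
        unfolding Bochner_Integration.integral_add[OF K_int[OF add.hyps(3) ub(2)] K_int[OF add.hyps(1) ub(1)]]
        by (simp add: distrib_left)
      finally show "expectation (\<lambda>\<omega>. Z \<omega> * (v (V \<omega>) + u (V \<omega>))) = expectation (\<lambda>\<omega>. Z \<omega> * (\<integral>y. v y + u y \<partial>K (U \<omega>)))" .
    qed
  next
    case (seq W)
    note [measurable] = seq.hyps(1) h(1)
    show ?case
    proof (intro allI impI)
      fix C assume C: "\<forall>y. h y \<le> C"
      \<comment> \<open>An increasing sequence stays below its limit, so the bound of h serves all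
        approximants.\<close>
      have Wle: "W i y \<le> h y" for i y
        using seq.hyps(4)[of y] seq.hyps(3) by (intro incseq_le) (auto simp: incseq_def le_fun_def)
      have Wb: "\<bar>W i y\<bar> \<le> C" for i y using seq.hyps(2)[of i y] Wle[of i y] C by (auto intro: order.trans)
      have hb: "\<bar>h y\<bar> \<le> C" for y using C h by auto
      have eq: "expectation (\<lambda>\<omega>. Z \<omega> * W i (V \<omega>)) = expectation (\<lambda>\<omega>. Z \<omega> * (\<integral>y. W i y \<partial>K (U \<omega>)))" for i
        using seq.IH[of i] Wb by (meson abs_le_D1)
      have dom: "norm (Z \<omega> * w) \<le> C * \<bar>Z \<omega>\<bar>" if "\<bar>w\<bar> \<le> C" for w \<omega>
        using that by (simp add: abs_mult mult.commute[of C] mult_left_mono)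
      have "(\<lambda>i. expectation (\<lambda>\<omega>. Z \<omega> * W i (V \<omega>))) \<longlonglongrightarrow> expectation (\<lambda>\<omega>. Z \<omega> * h (V \<omega>))"
        using Z Wb seq.hyps(4)
        by (intro integral_dominated_convergence[where w = "\<lambda>\<omega>. C * \<bar>Z \<omega>\<bar>"] AE_I2 dom tendsto_intros) auto
      moreover have "(\<lambda>i. expectation (\<lambda>\<omega>. Z \<omega> * (\<integral>y. W i y \<partial>K (U \<omega>)))) \<longlonglongrightarrow>
          expectation (\<lambda>\<omega>. Z \<omega> * (\<integral>y. h y \<partial>K (U \<omega>)))"
      proof (intro integral_dominated_convergence[where w = "\<lambda>\<omega>. C * \<bar>Z \<omega>\<bar>"] AE_I2 dom tendsto_mult tendsto_const)
        fix \<omega>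
        interpret K: prob_space "K (U \<omega>)" by (rule Kp)
        have m: "f \<in> borel_measurable (K (U \<omega>))" if "f \<in> borel_measurable borel" for f :: "'b \<Rightarrow> real"
          using that by (subst measurable_cong_sets[OF Kp(2) refl])
        show "(\<lambda>i. \<integral>y. W i y \<partial>K (U \<omega>)) \<longlonglongrightarrow> (\<integral>y. h y \<partial>K (U \<omega>))"
          using Wb seq.hyps(4)
          by (intro integral_dominated_convergence[where w = "\<lambda>_. C"] AE_I2 m) auto
      qed (use Z Wb K_meas[OF h(1) hb] K_meas[OF seq.hyps(1) Wb] in \<open>auto intro!: K_bd\<close>)
      ultimately show "expectation (\<lambda>\<omega>. Z \<omega> * h (V \<omega>)) = expectation (\<lambda>\<omega>. Z \<omega> * (\<integral>y. h y \<partial>K (U \<omega>)))"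
        unfolding eq by (rule LIMSEQ_unique)
    qed
  qed
  then show ?thesis using h by blast
qed

text \<open>The shifted function h + C is nonnegative, and the shift adds C E[Z] on both sides
  because every K y has mass 1.\<close>

lemma (in prob_space) kernel_expectation:
  fixes Z :: "'a \<Rightarrow> real" and U V :: "'a \<Rightarrow> 'b::topological_space" and h :: "'b \<Rightarrow> real"
  assumes Z: "integrable M Z"
    and U: "U \<in> borel_measurable M" and V: "V \<in> borel_measurable M"
    and K: "K \<in> borel \<rightarrow>\<^sub>M prob_algebra borel"
    and base: "\<And>A. A \<in> sets borel \<Longrightarrow>
      expectation (\<lambda>\<omega>. Z \<omega> * indicator A (V \<omega>)) = expectation (\<lambda>\<omega>. Z \<omega> * measure (K (U \<omega>)) A)"
    and h: "h \<in> borel_measurable borel" "\<And>y. \<bar>h y\<bar> \<le> C"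
  shows "expectation (\<lambda>\<omega>. Z \<omega> * h (V \<omega>)) = expectation (\<lambda>\<omega>. Z \<omega> * (\<integral>y. h y \<partial>K (U \<omega>)))"
proof -
  have hb: "0 \<le> h y + C" "h y + C \<le> 2 * C" for y using h(2)[of y] by auto
  have "expectation (\<lambda>\<omega>. Z \<omega> * h (V \<omega>)) + C * expectation Z = expectation (\<lambda>\<omega>. Z \<omega> * h (V \<omega>) + C * Z \<omega>)"
    using Z integrable_mult_bounded[OF Z measurable_compose[OF V h(1)] h(2)] by simp
  also have "\<dots> = expectation (\<lambda>\<omega>. Z \<omega> * (h (V \<omega>) + C))"
    by (intro Bochner_Integration.integral_cong) (auto simp: distrib_left)
  also have "\<dots> = expectation (\<lambda>\<omega>. Z \<omega> * (\<integral>y. h y + C \<partial>K (U \<omega>)))"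
    using hb h(1) by (intro kernel_expectation_nonneg[OF Z U V K base, where h = "\<lambda>y. h y + C" and C = "2 * C"]) auto
  also have "\<dots> = expectation (\<lambda>\<omega>. Z \<omega> * (\<integral>y. h y \<partial>K (U \<omega>)) + C * Z \<omega>)"
  proof (intro Bochner_Integration.integral_cong refl)
    fix \<omega>
    interpret K: prob_space "K (U \<omega>)" by (rule prob_kernel[OF K])
    show "Z \<omega> * (\<integral>y. h y + C \<partial>K (U \<omega>)) = Z \<omega> * (\<integral>y. h y \<partial>K (U \<omega>)) + C * Z \<omega>"
      using prob_kernel_bounded(1)[OF K h, of "U \<omega>"] K.prob_space by (simp add: distrib_left)
  qed
  also have "\<dots> = expectation (\<lambda>\<omega>. Z \<omega> * (\<integral>y. h y \<partial>K (U \<omega>))) + C * expectation Z"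
    using Z integrable_mult_bounded[OF Z measurable_compose[OF U prob_kernel_bounded(3)[OF K h]] prob_kernel_bounded(2)[OF K h]]
    by simp
  finally show ?thesis by simp
qed

text \<open>The two densities differ in L1 by at most B (t - u) u^(-\<beta>): pointwise in y, the
  time derivative is integrated over [u, t] and dominated by q; Tonelli then exchanges the
  integrals, and q has mass 1 in y for every time. Where the time integral of q is infinite, the
  pointwise bound is trivial.\<close>

lemma transition_diff_le:
  fixes P :: "real \<Rightarrow> 'a::euclidean_space \<Rightarrow> 'a measure"
  assumes P: "transition_function P" and X: "condition_X T P B \<beta> q"
    and ut: "0 < u" "u \<le> t" "t \<le> T"
    and [measurable]: "h \<in> borel_measurable borel" and h: "\<And>y. \<bar>h y\<bar> \<le> H"
  shows "\<bar>(\<integral>y. h y \<partial>P t x) - (\<integral>y. h y \<partial>P u x)\<bar> \<le> H * (B * (t - u) * u powr (- \<beta>))"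
proof -
  have B: "B \<ge> 1" and \<beta>: "\<beta> \<ge> 1"
    and q_meas[measurable]: "(\<lambda>(t, x, y). q t x y) \<in> borel_measurable (restrict_space borel {0<..T} \<Otimes>\<^sub>M borel \<Otimes>\<^sub>M borel)"
    and q: "\<And>t x y. t \<in> {0<..T} \<Longrightarrow> 0 \<le> q t x y" "\<And>t x. t \<in> {0<..T} \<Longrightarrow> (\<integral>\<^sup>+ y. ennreal (q t x y) \<partial>lborel) = 1"
    using X unfolding condition_X_def by auto
  obtain d where D: "\<forall>t>0. \<forall>x. d t x \<in> borel_measurable borel \<and> (\<forall>y. 0 \<le> d t x y) \<and>
        P t x = density lborel (\<lambda>y. ennreal (d t x y))"
      "\<forall>t>0. \<forall>x y. (\<lambda>s. d s x y) differentiable (at t)"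
      "\<forall>t\<in>{0<..T}. \<forall>x y. \<bar>deriv (\<lambda>s. d s x y) t\<bar> \<le> B * t powr (- \<beta>) * q t x y"
    using X unfolding condition_X_def by blast
  have d: "\<And>t x. t > 0 \<Longrightarrow> d t x \<in> borel_measurable borel" "\<And>t x y. t > 0 \<Longrightarrow> 0 \<le> d t x y"
      "\<And>t x. t > 0 \<Longrightarrow> P t x = density lborel (\<lambda>y. ennreal (d t x y))"
      "\<And>t x y. t > 0 \<Longrightarrow> (\<lambda>s. d s x y) differentiable (at t)"
      "\<And>t x y. t \<in> {0<..T} \<Longrightarrow> \<bar>deriv (\<lambda>s. d s x y) t\<bar> \<le> B * t powr (- \<beta>) * q t x y"
    using D by blast+
  have H: "0 \<le> H" using h[of undefined] by linarith
  have t: "0 < t" using ut by simp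
  define b where "b = B * u powr (- \<beta>)"
  have b: "b > 0" using B ut by (simp add: b_def)
  \<comment> \<open>The function q is jointly measurable only for times in (0, T]. Clamping time to
    [u, t] makes it measurable on the whole line and changes nothing on the interval of
    integration.\<close>
  define cl where "cl r = max u (min t r)" for r
  have cl: "cl r \<in> {0<..T}" for r using ut by (auto simp: cl_def)
  have [measurable]: "cl \<in> borel \<rightarrow>\<^sub>M restrict_space borel {0<..T}"
    using cl by (intro measurable_restrict_space2) (auto simp: cl_def[abs_def])
  have cl_eq: "cl r = r" if "r \<in> {u..t}" for r using that by (auto simp: cl_def)
  have [measurable]: "(\<lambda>(r, y). q (cl r) x y) \<in> borel_measurable (borel \<Otimes>\<^sub>M borel)"
  proof -
    have "(\<lambda>(r, y). (cl r, x, y)) \<in> borel \<Otimes>\<^sub>M borel \<rightarrow>\<^sub>M restrict_space borel {0<..T} \<Otimes>\<^sub>M borel \<Otimes>\<^sub>M borel"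
      by measurable
    from measurable_compose[OF this q_meas] show ?thesis by (simp add: case_prod_beta')
  qed
  let ?W = "\<lambda>y r. ennreal (indicator {u..t} r * (b * q (cl r) x y))"
  have pw: "ennreal \<bar>d t x y - d u x y\<bar> \<le> (\<integral>\<^sup>+r. ?W y r \<partial>lborel)" for y
  proof (cases "(\<integral>\<^sup>+r. ?W y r \<partial>lborel) = \<infinity>")
    case False
    have nn: "0 \<le> indicator {u..t} r * (b * q (cl r) x y)" for r using b q cl by simp
    have int: "integrable lborel (\<lambda>r. indicator {u..t} r * (b * q (cl r) x y))"
      using False nn by (intro integrableI_nonneg) (auto simp: less_top[symmetric])
    then have si: "set_integrable lborel {u..t} (\<lambda>r. b * q (cl r) x y)"
      by (simp add: set_integrable_def)
    \<comment> \<open>The time derivative is not assumed continuous. The gauge integral recovers a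
      function from any derivative, so it is used for the derivative itself; Lebesgue integrability
      is required only of the dominating function.\<close>
    have ftc: "((\<lambda>r. deriv (\<lambda>s. d s x y) r) has_integral (d t x y - d u x y)) {u..t}"
    proof (rule fundamental_theorem_of_calculus)
      fix r assume r: "r \<in> {u..t}"
      then have "((\<lambda>s. d s x y) has_field_derivative deriv (\<lambda>s. d s x y) r) (at r)"
        using d(4) ut by (metis DERIV_deriv_iff_real_differentiable atLeastAtMost_iff order_less_le_trans)
      then show "((\<lambda>s. d s x y) has_vector_derivative deriv (\<lambda>s. d s x y) r) (at r within {u..t})"
        by (metis has_real_derivative_iff_has_vector_derivative has_vector_derivative_at_within)
    qed (use ut in auto)
    have "norm (integral {u..t} (\<lambda>r. deriv (\<lambda>s. d s x y) r)) \<le> integral {u..t} (\<lambda>r. b * q (cl r) x y)"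
    proof (rule integral_norm_bound_integral)
      show "(\<lambda>r. b * q (cl r) x y) integrable_on {u..t}"
        by (rule set_borel_integral_eq_integral(1)[OF si])
      show "(\<lambda>r. deriv (\<lambda>s. d s x y) r) integrable_on {u..t}" using ftc by blast
      fix r assume r: "r \<in> {u..t}"
      then have r': "r \<in> {0<..T}" using ut by auto
      have "\<bar>deriv (\<lambda>s. d s x y) r\<bar> \<le> B * r powr (- \<beta>) * q r x y" by (rule d(5)[OF r'])
      also have "\<dots> \<le> B * u powr (- \<beta>) * q r x y"
        using r r' \<beta> ut B q(1)[OF r'] by (intro mult_right_mono mult_left_mono powr_mono2') auto
      finally show "norm (deriv (\<lambda>s. d s x y) r) \<le> b * q (cl r) x y" using cl_eq[OF r] by (simp add: b_def)
    qed
    then have "\<bar>d t x y - d u x y\<bar> \<le> (LINT r:{u..t}|lborel. b * q (cl r) x y)"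
      unfolding set_borel_integral_eq_integral(2)[OF si] integral_unique[OF ftc] by simp
    also have "\<dots> = (\<integral>r. indicator {u..t} r * (b * q (cl r) x y) \<partial>lborel)"
      unfolding set_lebesgue_integral_def real_scaleR_def ..
    finally show ?thesis
      using nn_integral_eq_integral[OF int] nn by (simp add: ennreal_leI)
  qed simp
  have [measurable]: "d t x \<in> borel_measurable borel" "d u x \<in> borel_measurable borel"
    using d(1) ut t by auto
  have "(\<integral>\<^sup>+y. ennreal \<bar>d t x y - d u x y\<bar> \<partial>lborel) \<le> (\<integral>\<^sup>+y. (\<integral>\<^sup>+r. ?W y r \<partial>lborel) \<partial>lborel)"
    by (intro nn_integral_mono pw)
  also have "\<dots> = (\<integral>\<^sup>+r. (\<integral>\<^sup>+y. ?W y r \<partial>lborel) \<partial>lborel)"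
    by (rule lborel_pair.Fubini') measurable
  also have "\<dots> = (\<integral>\<^sup>+r. ennreal b * indicator {u..t} r \<partial>lborel)"
  proof (intro nn_integral_cong)
    fix r :: real
    have [measurable]: "(\<lambda>y. q (cl r) x y) \<in> borel_measurable borel" by measurable
    have "(\<integral>\<^sup>+y. ?W y r \<partial>lborel) = (\<integral>\<^sup>+y. ennreal (indicator {u..t} r * b) * ennreal (q (cl r) x y) \<partial>lborel)"
      using b q(1)[OF cl] by (intro nn_integral_cong) (simp add: mult.assoc flip: ennreal_mult)
    also have "\<dots> = ennreal (indicator {u..t} r * b)"
      using q(2)[OF cl] by (simp add: nn_integral_cmult)
    finally show "(\<integral>\<^sup>+y. ?W y r \<partial>lborel) = ennreal b * indicator {u..t} r"
      by (simp split: split_indicator)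
  qed
  also have "\<dots> = ennreal (b * (t - u))"
    using b ut by (simp add: nn_integral_cmult ennreal_mult)
  finally have L1: "(\<integral>\<^sup>+y. ennreal \<bar>d t x y - d u x y\<bar> \<partial>lborel) \<le> ennreal (b * (t - u))" .
  have P_prob: "prob_space (P r x)" if "r > 0" for r
  proof -
    have "P r \<in> borel \<rightarrow>\<^sub>M prob_algebra borel" using P that by (auto simp: transition_function_def)
    then have "P r x \<in> space (prob_algebra borel)" by (rule measurable_space) auto
    then show ?thesis by (auto simp: space_prob_algebra)
  qed
  have d_int: "integrable lborel (d r x)" if "r > 0" for r
  proof -
    have [measurable]: "d r x \<in> borel_measurable borel" using d(1) that by auto
    have "emeasure (P r x) (space (P r x)) = 1" using P_prob[OF that] by (rule prob_space.emeasure_space_1)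
    then have "(\<integral>\<^sup>+y. ennreal (d r x y) \<partial>lborel) = 1"
      using d(3)[OF that, of x] by (simp add: emeasure_density)
    then show ?thesis using d(2)[OF that] by (intro integrableI_nonneg) auto
  qed
  have Ph: "(\<integral>y. h y \<partial>P r x) = (\<integral>y. d r x y * h y \<partial>lborel)" if "r > 0" for r
    using d(1)[OF that, of x] d(2)[OF that, of x] by (simp add: d(3)[OF that] integral_density)
  have dh_int: "integrable lborel (\<lambda>y. d r x y * h y)" if "r > 0" for r
    using h by (intro integrable_mult_bounded[OF d_int[OF that], where C = H]) auto
  have eq: "(\<integral>y. h y \<partial>P t x) - (\<integral>y. h y \<partial>P u x) = (\<integral>y. (d t x y - d u x y) * h y \<partial>lborel)"
    using dh_int t ut(1) by (simp add: Ph left_diff_distrib)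
  have "ennreal \<bar>(\<integral>y. h y \<partial>P t x) - (\<integral>y. h y \<partial>P u x)\<bar>
      \<le> (\<integral>\<^sup>+y. ennreal (norm ((d t x y - d u x y) * h y)) \<partial>lborel)"
    using integral_norm_bound_ennreal[of lborel "\<lambda>y. (d t x y - d u x y) * h y"] dh_int t ut(1)
    by (simp add: eq left_diff_distrib)
  also have "\<dots> \<le> (\<integral>\<^sup>+y. ennreal H * ennreal \<bar>d t x y - d u x y\<bar> \<partial>lborel)"
    using h H by (intro nn_integral_mono)
      (auto simp: abs_mult mult.commute[of H] intro!: ennreal_leI mult_left_mono simp flip: ennreal_mult)
  also have "\<dots> = ennreal H * (\<integral>\<^sup>+y. ennreal \<bar>d t x y - d u x y\<bar> \<partial>lborel)"
    by (rule nn_integral_cmult) measurable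
  also have "\<dots> \<le> ennreal H * ennreal (b * (t - u))"
    by (intro mult_left_mono L1) simp
  also have "\<dots> = ennreal (H * (b * (t - u)))"
    using H b ut by (simp add: ennreal_mult)
  finally have "\<bar>(\<integral>y. h y \<partial>P t x) - (\<integral>y. h y \<partial>P u x)\<bar> \<le> H * (b * (t - u))"
    using H b ut by (subst (asm) ennreal_le_iff) auto
  then show ?thesis by (simp add: b_def mult_ac)
qed

section \<open>Time integrals of a Markov process\<close>

text \<open>With Y bounded by c, the product is dominated by c |Z| on a bounded time interval, which
  suffices for Fubini with any integrable weight Z.\<close>

lemma (in prob_space) fubini_bounded:
  fixes Y :: "real \<Rightarrow> 'a \<Rightarrow> real" and Z :: "'a \<Rightarrow> real"
  assumes Y[measurable]: "(\<lambda>(r, \<omega>). Y r \<omega>) \<in> borel_measurable (borel \<Otimes>\<^sub>M M)"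
    and bd: "\<And>r \<omega>. \<omega> \<in> space M \<Longrightarrow> \<bar>Y r \<omega>\<bar> \<le> c" and Z: "integrable M Z"
  shows "set_integrable lborel {a..<b} (\<lambda>r. expectation (\<lambda>\<omega>. Z \<omega> * Y r \<omega>))"
    and "expectation (\<lambda>\<omega>. Z \<omega> * (LINT r:{a..<b}|lborel. Y r \<omega>))
      = (LINT r:{a..<b}|lborel. expectation (\<lambda>\<omega>. Z \<omega> * Y r \<omega>))"
proof -
  interpret L: pair_sigma_finite lborel M ..
  have [measurable]: "Z \<in> borel_measurable M" using Z by simp
  have ind: "integrable lborel (indicat_real {a..<b})"
    by (cases "a \<le> b") auto
  have dom: "integrable (lborel \<Otimes>\<^sub>M M) (\<lambda>(r, \<omega>). indicator {a..<b} r * (c * \<bar>Z \<omega>\<bar>))"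
  proof (rule L.Fubini_integrable)
    show "integrable lborel (\<lambda>r. LINT \<omega>|M. norm (case (r, \<omega>) of (r, \<omega>) \<Rightarrow> indicator {a..<b} r * (c * \<bar>Z \<omega>\<bar>)))"
      using ind by (simp add: abs_mult)
  qed (use Z in auto)
  have int: "integrable (lborel \<Otimes>\<^sub>M M) (\<lambda>(r, \<omega>). indicator {a..<b} r * (Z \<omega> * Y r \<omega>))"
  proof (rule Bochner_Integration.integrable_bound[OF dom])
    show "AE x in lborel \<Otimes>\<^sub>M M. norm (case x of (r, \<omega>) \<Rightarrow> indicator {a..<b} r * (Z \<omega> * Y r \<omega>))
        \<le> norm (case x of (r, \<omega>) \<Rightarrow> indicator {a..<b} r * (c * \<bar>Z \<omega>\<bar>))"
    proof (rule AE_I2, clarsimp simp: space_pair_measure abs_mult)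
      fix r \<omega> assume "\<omega> \<in> space M"
      then have "\<bar>Y r \<omega>\<bar> \<le> \<bar>c\<bar>" using bd[of \<omega> r] by simp
      then show "indicator {a..<b} r * (\<bar>Z \<omega>\<bar> * \<bar>Y r \<omega>\<bar>) \<le> indicator {a..<b} r * (\<bar>c\<bar> * \<bar>Z \<omega>\<bar>)"
        by (intro mult_left_mono) (auto simp: mult.commute[of "\<bar>c\<bar>"] intro: mult_left_mono)
    qed
  qed measurable
  show "set_integrable lborel {a..<b} (\<lambda>r. expectation (\<lambda>\<omega>. Z \<omega> * Y r \<omega>))"
    using L.integrable_fst[OF int] by (simp add: set_integrable_def)
  have "expectation (\<lambda>\<omega>. Z \<omega> * (LINT r:{a..<b}|lborel. Y r \<omega>))
      = (\<integral>\<omega>. (\<integral>r. indicator {a..<b} r * (Z \<omega> * Y r \<omega>) \<partial>lborel) \<partial>M)"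
    by (simp add: set_lebesgue_integral_def mult.left_commute[of _ "Z _"])
  also have "\<dots> = (\<integral>r. (\<integral>\<omega>. indicator {a..<b} r * (Z \<omega> * Y r \<omega>) \<partial>M) \<partial>lborel)"
    by (rule L.Fubini_integral[OF int])
  finally show "expectation (\<lambda>\<omega>. Z \<omega> * (LINT r:{a..<b}|lborel. Y r \<omega>))
      = (LINT r:{a..<b}|lborel. expectation (\<lambda>\<omega>. Z \<omega> * Y r \<omega>))"
    by (simp add: set_lebesgue_integral_def)
qed

lemma set_integral_bounded:
  fixes f :: "real \<Rightarrow> real"
  assumes [measurable]: "f \<in> borel_measurable borel" and bd: "\<And>r. \<bar>f r\<bar> \<le> c" and ab: "a \<le> b"
  shows "set_integrable lborel {a..<b} f" "\<bar>LINT r:{a..<b}|lborel. f r\<bar> \<le> c * (b - a)"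
proof -
  have c: "set_integrable lborel {a..<b} (\<lambda>_. c)"
    using ab by (simp add: set_integrable_def)
  show int: "set_integrable lborel {a..<b} f"
    unfolding set_integrable_def
  proof (rule Bochner_Integration.integrable_bound[OF c[unfolded set_integrable_def]])
    have "\<bar>f r\<bar> \<le> \<bar>c\<bar>" for r using bd[of r] by linarith
    then show "AE r in lborel. norm (indicator {a..<b} r *\<^sub>R f r) \<le> norm (indicator {a..<b} r *\<^sub>R c)"
      by (intro AE_I2) (auto split: split_indicator)
  qed measurable
  have "\<bar>LINT r:{a..<b}|lborel. f r\<bar> \<le> (\<integral>r. \<bar>indicator {a..<b} r *\<^sub>R f r\<bar> \<partial>lborel)"
    unfolding set_lebesgue_integral_def by (rule integral_abs_bound)
  also have "\<dots> \<le> (\<integral>r. indicator {a..<b} r *\<^sub>R c \<partial>lborel)"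
    using int c bd unfolding set_integrable_def
    by (intro integral_mono) (auto split: split_indicator)
  also have "\<dots> = c * (b - a)" using ab by simp
  finally show "\<bar>LINT r:{a..<b}|lborel. f r\<bar> \<le> c * (b - a)" .
qed

text \<open>The process is only jointly measurable, not progressively measurable, so its time integrals
  need not be measurable for the natural filtration. They agree almost everywhere with their
  conditional expectations; this follows by duality, testing the difference against its sign.\<close>

lemma (in prob_space) adapted_integral:
  fixes Y :: "real \<Rightarrow> 'a \<Rightarrow> real"
  assumes Y[measurable]: "(\<lambda>(r, \<omega>). Y r \<omega>) \<in> borel_measurable (borel \<Otimes>\<^sub>M M)"
    and bd: "\<And>r \<omega>. \<omega> \<in> space M \<Longrightarrow> \<bar>Y r \<omega>\<bar> \<le> c"
    and G: "subalgebra M G" and ad: "\<And>r. r \<in> {a..<b} \<Longrightarrow> Y r \<in> borel_measurable G"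
    and ab: "a \<le> b"
  shows "AE \<omega> in M. real_cond_exp M G (\<lambda>\<omega>. LINT r:{a..<b}|lborel. Y r \<omega>) \<omega> = (LINT r:{a..<b}|lborel. Y r \<omega>)"
proof -
  interpret G: finite_measure_subalgebra M G by standard (rule G)
  define J where "J = (\<lambda>\<omega>. LINT r:{a..<b}|lborel. Y r \<omega>)"
  have J_meas[measurable]: "J \<in> borel_measurable M"
    unfolding J_def set_lebesgue_integral_def by measurable
  have Yr[measurable]: "Y r \<in> borel_measurable M" for r by measurable
  have J_bd: "\<bar>J \<omega>\<bar> \<le> c * (b - a)" if "\<omega> \<in> space M" for \<omega>
    unfolding J_def using that bd ab by (intro set_integral_bounded) auto
  have J_int: "integrable M J"
    using J_bd by (intro integrable_const_bound[where B = "c * (b - a)"] AE_I2) auto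
  define E where "E = real_cond_exp M G J"
  have E: "E \<in> borel_measurable G" "integrable M E"
    unfolding E_def using J_int by (auto intro: G.real_cond_exp_int)
  have [measurable]: "E \<in> borel_measurable M" using E by simp
  define W where "W = (\<lambda>\<omega>. sgn (J \<omega> - E \<omega>))"
  have [measurable]: "W \<in> borel_measurable M" unfolding W_def by measurable
  have W_bd: "\<bar>W \<omega>\<bar> \<le> 1" for \<omega> by (simp add: W_def sgn_if)
  have W_int: "integrable M W" using W_bd by (intro integrable_const_bound[where B = 1] AE_I2) auto
  define V where "V = real_cond_exp M G W"
  have V: "V \<in> borel_measurable G" "integrable M V"
    unfolding V_def using W_int by (auto intro: G.real_cond_exp_int)
  have YW: "expectation (\<lambda>\<omega>. W \<omega> * Y r \<omega>) = expectation (\<lambda>\<omega>. V \<omega> * Y r \<omega>)" if r: "r \<in> {a..<b}" for r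
  proof -
    have "integrable M (\<lambda>\<omega>. Y r \<omega> * W \<omega>)"
      using integrable_mult_bounded[OF W_int Yr bd] by (simp add: mult.commute)
    from G.real_cond_exp_intg(2)[OF this ad[OF r]] show ?thesis
      by (simp add: V_def mult.commute)
  qed
  \<comment> \<open>Three exchanges: W becomes V under the time integral, because each Y r is known
    to G; J becomes E, because V is known to G; V goes back to W, because E is known to G.\<close>
  have "expectation (\<lambda>\<omega>. W \<omega> * J \<omega>) = (LINT r:{a..<b}|lborel. expectation (\<lambda>\<omega>. W \<omega> * Y r \<omega>))"
    unfolding J_def by (rule fubini_bounded(2)[OF Y bd W_int])
  also have "\<dots> = (LINT r:{a..<b}|lborel. expectation (\<lambda>\<omega>. V \<omega> * Y r \<omega>))"
    by (intro set_lebesgue_integral_cong) (auto simp: YW)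
  also have "\<dots> = expectation (\<lambda>\<omega>. V \<omega> * J \<omega>)"
    unfolding J_def by (rule fubini_bounded(2)[OF Y bd V(2), symmetric])
  also have "\<dots> = expectation (\<lambda>\<omega>. V \<omega> * E \<omega>)"
    unfolding E_def
    by (rule G.real_cond_exp_intg(2)[symmetric, OF integrable_mult_bounded[OF V(2) J_meas J_bd] V(1) J_meas])
  also have "\<dots> = expectation (\<lambda>\<omega>. E \<omega> * W \<omega>)"
    using G.real_cond_exp_intg(2)[OF integrable_mult_bounded[OF E(2) _ W_bd] E(1)] by (simp add: V_def mult.commute)
  finally have eq: "expectation (\<lambda>\<omega>. W \<omega> * J \<omega>) = expectation (\<lambda>\<omega>. E \<omega> * W \<omega>)" .
  have "expectation (\<lambda>\<omega>. \<bar>J \<omega> - E \<omega>\<bar>) = expectation (\<lambda>\<omega>. W \<omega> * J \<omega> - E \<omega> * W \<omega>)"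
    by (intro Bochner_Integration.integral_cong) (auto simp: W_def sgn_if algebra_simps abs_if)
  also have "\<dots> = 0"
    using eq integrable_mult_bounded[OF W_int J_meas J_bd] integrable_mult_bounded[OF E(2) _ W_bd] by simp
  finally have "AE \<omega> in M. \<bar>J \<omega> - E \<omega>\<bar> = 0"
    using J_int E(2) by (subst (asm) integral_nonneg_eq_0_iff_AE) auto
  then have "AE \<omega> in M. E \<omega> = J \<omega>" by eventually_elim simp
  then show ?thesis by (simp only: E_def J_def)
qed

section \<open>The Markov property under one fixed initial law, tested against weights from the
  past\<close>

locale markov_law = prob_space M for M :: "'w measure" +
  fixes X :: "real \<Rightarrow> 'w \<Rightarrow> 'a::euclidean_space" and P :: "real \<Rightarrow> 'a \<Rightarrow> 'a measure"
    and h :: "'a \<Rightarrow> real" and H :: real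
  assumes X_meas: "(\<lambda>(t, \<omega>). X t \<omega>) \<in> borel_measurable (restrict_space borel {0..} \<Otimes>\<^sub>M M)"
    and P: "transition_function P"
    and markov: "\<And>s t A. 0 \<le> s \<Longrightarrow> 0 \<le> t \<Longrightarrow> A \<in> sets borel \<Longrightarrow> AE \<omega> in M.
      real_cond_exp M (natural_filtration M X s) (\<lambda>\<omega>. indicator A (X (s + t) \<omega>)) \<omega> = measure (P t (X s \<omega>)) A"
    and h_meas[measurable]: "h \<in> borel_measurable borel"
    and h_bd: "\<And>y. \<bar>h y\<bar> \<le> H"
begin

abbreviation G :: "real \<Rightarrow> 'w measure" where "G \<equiv> natural_filtration M X"

lemma X_measurable: "0 \<le> t \<Longrightarrow> X t \<in> borel_measurable M"
  using measurable_compose[OF measurable_Pair1' X_meas, of t] by (simp add: space_restrict_space)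

lemma space_G: "space (G s) = space M"
  unfolding natural_filtration_def by (rule space_measure_of) auto

lemma sets_G: "sets (G s) = sigma_sets (space M) {X u -` A \<inter> space M | u A. 0 \<le> u \<and> u \<le> s \<and> A \<in> sets borel}"
  unfolding natural_filtration_def by (rule sets_measure_of) auto

lemma subalgebra_G: "subalgebra M (G s)"
  unfolding subalgebra_def space_G sets_G
  by (auto intro!: sets.sigma_sets_subset measurable_sets[OF X_measurable])

lemma G_mono: "s \<le> t \<Longrightarrow> sets (G s) \<subseteq> sets (G t)"
  unfolding sets_G by (intro sigma_sets_mono') (auto intro: order.trans)

lemma measurable_G_mono: "s \<le> t \<Longrightarrow> f \<in> borel_measurable (G s) \<Longrightarrow> f \<in> borel_measurable (G t)"
  using G_mono[of s t] by (auto simp: measurable_def space_G)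

lemma X_adapted: "0 \<le> u \<Longrightarrow> u \<le> s \<Longrightarrow> X u \<in> borel_measurable (G s)"
  by (rule measurableI) (auto simp: space_G sets_G intro!: sigma_sets.Basic)

lemma P_kernel: "0 \<le> t \<Longrightarrow> P t \<in> borel \<rightarrow>\<^sub>M prob_algebra borel"
  using P by (simp add: transition_function_def)

text \<open>A weight known at time s may be multiplied into the conditional expectation. This gives
  the identity for indicators, from which \<open>kernel_expectation\<close> reaches h.\<close>

lemma markov_expectation:
  assumes st: "0 \<le> s" "s \<le> t" and Z: "integrable M Z" "Z \<in> borel_measurable (G s)"
  shows "expectation (\<lambda>\<omega>. Z \<omega> * h (X t \<omega>)) = expectation (\<lambda>\<omega>. Z \<omega> * (\<integral>y. h y \<partial>P (t - s) (X s \<omega>)))"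
proof (rule kernel_expectation[OF Z(1) X_measurable X_measurable P_kernel _ h_meas h_bd])
  fix A :: "'a set" assume A[measurable]: "A \<in> sets borel"
  interpret G: finite_measure_subalgebra M "G s" by standard (rule subalgebra_G)
  have Xs: "X s \<in> borel_measurable M" "X t \<in> borel_measurable M" using st by (auto intro: X_measurable)
  have ind: "(\<lambda>\<omega>. indicator A (X t \<omega>) :: real) \<in> borel_measurable M"
    by (rule measurable_compose[OF Xs(2)]) measurable
  have mea: "(\<lambda>\<omega>. measure (P (t - s) (X s \<omega>)) A) \<in> borel_measurable M"
    using st by (intro measurable_compose[OF Xs(1)]
      measurable_compose[OF measurable_prob_algebraD[OF P_kernel] measurable_measure_subprob_algebra] A) auto
  have "expectation (\<lambda>\<omega>. Z \<omega> * indicator A (X t \<omega>))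
      = expectation (\<lambda>\<omega>. Z \<omega> * real_cond_exp M (G s) (\<lambda>\<omega>. indicator A (X t \<omega>)) \<omega>)"
    by (rule G.real_cond_exp_intg(2)[symmetric, OF integrable_mult_bounded[OF Z(1) ind, where C = 1] Z(2) ind])
      (auto split: split_indicator)
  also have "\<dots> = expectation (\<lambda>\<omega>. Z \<omega> * measure (P (t - s) (X s \<omega>)) A)"
  proof (rule integral_cong_AE)
    show "AE \<omega> in M. Z \<omega> * real_cond_exp M (G s) (\<lambda>\<omega>. indicator A (X t \<omega>)) \<omega>
        = Z \<omega> * measure (P (t - s) (X s \<omega>)) A"
      using markov[OF st(1) _ A, of "t - s"] st by auto
  qed (use Z(1) mea in measurable)
  finally show "expectation (\<lambda>\<omega>. Z \<omega> * indicator A (X t \<omega>))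
      = expectation (\<lambda>\<omega>. Z \<omega> * measure (P (t - s) (X s \<omega>)) A)" .
qed (use st in auto)

text \<open>Both times are viewed from s, so the kernels P (t - s) and P (u - s) start at the same
  point X s and \<open>transition_diff_le\<close> applies for each outcome. The strict gap s < u
  stays clear of the singularity at time 0.\<close>

lemma markov_diff_le:
  assumes X: "condition_X T P B \<beta> q" and st: "0 \<le> s" "s < u" "u \<le> t" "t \<le> T"
    and Z: "integrable M Z" "Z \<in> borel_measurable (G s)"
  shows "\<bar>expectation (\<lambda>\<omega>. Z \<omega> * (h (X t \<omega>) - h (X u \<omega>)))\<bar>
    \<le> expectation (\<lambda>\<omega>. \<bar>Z \<omega>\<bar>) * (H * (B * (t - u) * (u - s) powr (- \<beta>)))"
proof -
  let ?C = "H * (B * (t - u) * (u - s) powr (- \<beta>))"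
  have Xm: "X s \<in> borel_measurable M" "X t \<in> borel_measurable M" "X u \<in> borel_measurable M"
    using st by (auto intro: X_measurable)
  have hX: "integrable M (\<lambda>\<omega>. Z \<omega> * h (X r \<omega>))" if "0 \<le> r" for r
    by (rule integrable_mult_bounded[OF Z(1) measurable_compose[OF X_measurable[OF that] h_meas] h_bd])
  have hP: "integrable M (\<lambda>\<omega>. Z \<omega> * (\<integral>y. h y \<partial>P r (X s \<omega>)))" if "0 \<le> r" for r
    by (rule integrable_mult_bounded[OF Z(1) measurable_compose[OF Xm(1)
      prob_kernel_bounded(3)[OF P_kernel[OF that] h_meas h_bd]] prob_kernel_bounded(2)[OF P_kernel[OF that] h_meas h_bd]])
  have "expectation (\<lambda>\<omega>. Z \<omega> * (h (X t \<omega>) - h (X u \<omega>)))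
      = expectation (\<lambda>\<omega>. Z \<omega> * h (X t \<omega>)) - expectation (\<lambda>\<omega>. Z \<omega> * h (X u \<omega>))"
    unfolding right_diff_distrib using st by (intro Bochner_Integration.integral_diff hX) auto
  also have "\<dots> = expectation (\<lambda>\<omega>. Z \<omega> * (\<integral>y. h y \<partial>P (t - s) (X s \<omega>)))
      - expectation (\<lambda>\<omega>. Z \<omega> * (\<integral>y. h y \<partial>P (u - s) (X s \<omega>)))"
    using st by (simp add: markov_expectation[OF _ _ Z])
  also have "\<dots> = expectation (\<lambda>\<omega>. Z \<omega> * ((\<integral>y. h y \<partial>P (t - s) (X s \<omega>)) - (\<integral>y. h y \<partial>P (u - s) (X s \<omega>))))"
    unfolding right_diff_distrib using st by (intro Bochner_Integration.integral_diff[symmetric] hP) auto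
  finally have "\<bar>expectation (\<lambda>\<omega>. Z \<omega> * (h (X t \<omega>) - h (X u \<omega>)))\<bar>
      \<le> expectation (\<lambda>\<omega>. \<bar>Z \<omega> * ((\<integral>y. h y \<partial>P (t - s) (X s \<omega>)) - (\<integral>y. h y \<partial>P (u - s) (X s \<omega>)))\<bar>)"
    by (simp only: integral_abs_bound)
  also have "\<dots> \<le> expectation (\<lambda>\<omega>. \<bar>Z \<omega>\<bar> * ?C)"
  proof (rule integral_mono)
    show "integrable M (\<lambda>\<omega>. \<bar>Z \<omega> * ((\<integral>y. h y \<partial>P (t - s) (X s \<omega>)) - (\<integral>y. h y \<partial>P (u - s) (X s \<omega>)))\<bar>)"
      unfolding right_diff_distrib using st by (intro integrable_abs Bochner_Integration.integrable_diff hP) auto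
    show "integrable M (\<lambda>\<omega>. \<bar>Z \<omega>\<bar> * ?C)" using Z by simp
    fix \<omega>
    have "\<bar>(\<integral>y. h y \<partial>P (t - s) (X s \<omega>)) - (\<integral>y. h y \<partial>P (u - s) (X s \<omega>))\<bar>
        \<le> H * (B * ((t - s) - (u - s)) * (u - s) powr (- \<beta>))"
      using st by (intro transition_diff_le[OF P X] h_meas h_bd) auto
    then show "\<bar>Z \<omega> * ((\<integral>y. h y \<partial>P (t - s) (X s \<omega>)) - (\<integral>y. h y \<partial>P (u - s) (X s \<omega>)))\<bar> \<le> \<bar>Z \<omega>\<bar> * ?C"
      unfolding abs_mult by (intro mult_left_mono) auto
  qed
  also have "\<dots> = expectation (\<lambda>\<omega>. \<bar>Z \<omega>\<bar>) * ?C" by simp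
  finally show ?thesis .
qed

end

text \<open>This turns the Riemann sum into a time integral, so that the error is a single integral
  of h(X r) - h(X (\<eta> r)). On half-open cells the floor is constant, which permits adding one
  cell at a time.\<close>

lemma floor_step_integral:
  fixes a :: "real \<Rightarrow> real"
  assumes \<delta>: "\<delta> > 0"
  shows "set_integrable lborel {0..<real n * \<delta>} (\<lambda>r. a (\<delta> * of_int \<lfloor>r / \<delta>\<rfloor>)) \<and>
    (LINT r:{0..<real n * \<delta>}|lborel. a (\<delta> * of_int \<lfloor>r / \<delta>\<rfloor>)) = \<delta> * (\<Sum>k<n. a (real k * \<delta>))"
proof (induction n)
  case 0
  then show ?case by (simp add: set_integrable_def set_lebesgue_integral_def)
next
  case (Suc n)
  let ?f = "\<lambda>r. a (\<delta> * of_int \<lfloor>r / \<delta>\<rfloor>)"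
  let ?I = "{real n * \<delta>..<real (Suc n) * \<delta>}"
  have split: "{0..<real (Suc n) * \<delta>} = {0..<real n * \<delta>} \<union> ?I"
    using \<delta> by (subst ivl_disj_un_two(3)) (auto intro: mult_right_mono)
  have f: "?f r = a (real n * \<delta>)" if "r \<in> ?I" for r
  proof -
    have "\<lfloor>r / \<delta>\<rfloor> = int n"
      using that \<delta> by (intro floor_unique) (auto simp: field_simps)
    then show ?thesis by (simp add: mult.commute)
  qed
  have const: "set_integrable lborel ?I (\<lambda>_. a (real n * \<delta>))"
    using \<delta> by (simp add: set_integrable_def distrib_right)
  have int: "set_integrable lborel ?I ?f"
    using const by (subst set_integrable_cong[OF refl refl f]) auto
  have val: "(LINT r:?I|lborel. ?f r) = \<delta> * a (real n * \<delta>)"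
  proof -
    have "(LINT r:?I|lborel. ?f r) = (LINT r:?I|lborel. a (real n * \<delta>))"
      by (intro set_lebesgue_integral_cong) (simp, use f in blast)
    then show ?thesis using \<delta> by (simp add: set_lebesgue_integral_def distrib_right)
  qed
  have "set_integrable lborel {0..<real (Suc n) * \<delta>} ?f"
    unfolding split using Suc int by (intro set_integrable_Un) auto
  moreover have "(LINT r:{0..<real (Suc n) * \<delta>}|lborel. ?f r)
      = (LINT r:{0..<real n * \<delta>}|lborel. ?f r) + (LINT r:?I|lborel. ?f r)"
    unfolding split using Suc int by (intro set_integral_Un) auto
  ultimately show ?case using Suc val by (simp add: distrib_left)
qed

section \<open>Moments of the Riemann sum error for a general window\<close>

context markov_law
begin

text \<open>The antiderivative \<Phi> of r^(-\<beta>) stays abstract, so that the logarithm for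
  \<beta> = 1 and the power for \<beta> > 1 share one proof. In L the first summand is the window
  and the second the integral of the kernel bound beyond it.\<close>

lemma riemann_sum_moment:
  assumes cX: "condition_X T P B \<beta> q" and T: "T > 0" and n: "n > 0" and p: "p \<ge> 2" and H: "H > 0"
    and \<delta>: "\<delta> = T / real n" and \<epsilon>: "0 < \<epsilon>" "\<epsilon> \<le> T"
    and \<Phi>: "\<And>r. r > 0 \<Longrightarrow> (\<Phi> has_real_derivative r powr (- \<beta>)) (at r)"
    and L: "L = H * (2 * (\<epsilon> + \<delta>) + B * \<delta> * (\<Phi> T - \<Phi> \<epsilon>))"
  shows "expectation (\<lambda>\<omega>. \<bar>I_int X T h \<omega> - I_sum X T n h \<omega>\<bar> powr p) \<le> (p * (p - 1) * (2 * H) * L * T) powr (p / 2)"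
    and "0 \<le> r \<Longrightarrow> integrable M (\<lambda>\<omega>. \<bar>I_int X T h \<omega> - I_sum X T n h \<omega>\<bar> powr r)"
proof -
  have B: "B \<ge> 1" and \<beta>: "\<beta> \<ge> 1" using cX by (auto simp: condition_X_def)
  have \<delta>0: "\<delta> > 0" using T n \<delta> by simp
  have \<delta>n: "real n * \<delta> = T" using n \<delta> by simp
  define \<eta> where "\<eta> r = \<delta> * of_int \<lfloor>r / \<delta>\<rfloor>" for r
  have \<eta>: "\<eta> r \<le> r" "r - \<delta> < \<eta> r" "0 \<le> r \<Longrightarrow> 0 \<le> \<eta> r" for r
  proof -
    have "\<delta> * of_int \<lfloor>r / \<delta>\<rfloor> \<le> \<delta> * (r / \<delta>)" using \<delta>0 by (intro mult_left_mono) auto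
    then show "\<eta> r \<le> r" using \<delta>0 by (simp add: \<eta>_def)
    have "\<delta> * (r / \<delta>) < \<delta> * (of_int \<lfloor>r / \<delta>\<rfloor> + 1)" using \<delta>0 by (intro mult_strict_left_mono) auto
    then show "r - \<delta> < \<eta> r" using \<delta>0 by (simp add: \<eta>_def distrib_left)
    show "0 \<le> r \<Longrightarrow> 0 \<le> \<eta> r" using \<delta>0 by (simp add: \<eta>_def)
  qed
  have \<eta>_meas[measurable]: "\<eta> \<in> borel_measurable borel"
    unfolding \<eta>_def[abs_def] by measurable
  \<comment> \<open>X is jointly measurable for nonnegative times only. The maximum with 0 extends
    the integrand to all real times and is invisible on [0, T].\<close>
  define Y where "Y r \<omega> = h (X (max 0 r) \<omega>) - h (X (max 0 (\<eta> r)) \<omega>)" for r \<omega>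
  have Xc: "(\<lambda>(r, \<omega>). h (X (max 0 (f r)) \<omega>)) \<in> borel_measurable (borel \<Otimes>\<^sub>M M)"
    if [measurable]: "f \<in> borel_measurable borel" for f :: "real \<Rightarrow> real"
  proof -
    have [measurable]: "(\<lambda>r. max 0 (f r)) \<in> borel \<rightarrow>\<^sub>M restrict_space borel {0..}"
      by (intro measurable_restrict_space2) auto
    have "(\<lambda>(r, \<omega>). (max 0 (f r), \<omega>)) \<in> borel \<Otimes>\<^sub>M M \<rightarrow>\<^sub>M restrict_space borel {0..} \<Otimes>\<^sub>M M"
      by measurable
    from measurable_compose[OF measurable_compose[OF this X_meas] h_meas] show ?thesis
      by (simp add: case_prod_beta')
  qed
  have [measurable]: "(\<lambda>(r, \<omega>). h (X (max 0 r) \<omega>)) \<in> borel_measurable (borel \<Otimes>\<^sub>M M)"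
    "(\<lambda>(r, \<omega>). h (X (max 0 (\<eta> r)) \<omega>)) \<in> borel_measurable (borel \<Otimes>\<^sub>M M)"
    using Xc[of "\<lambda>r. r"] Xc[of \<eta>] by simp_all
  have Y_meas[measurable]: "(\<lambda>(r, \<omega>). Y r \<omega>) \<in> borel_measurable (borel \<Otimes>\<^sub>M M)"
    unfolding Y_def by measurable
  have Y_bd: "\<bar>Y r \<omega>\<bar> \<le> 2 * H" for r \<omega>
    using h_bd[of "X (max 0 r) \<omega>"] h_bd[of "X (max 0 (\<eta> r)) \<omega>"] unfolding Y_def by linarith
  have Y_path: "(\<lambda>r. Y r \<omega>) \<in> borel_measurable borel" "(\<lambda>r. h (X (max 0 r) \<omega>)) \<in> borel_measurable borel"
    if "\<omega> \<in> space M" for \<omega>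
    using that by measurable
  define J where "J t \<omega> = (LINT r:{0..<t}|lborel. Y r \<omega>)" for t \<omega>
  have J_meas[measurable]: "J t \<in> borel_measurable M" for t
    unfolding J_def set_lebesgue_integral_def by measurable
  have J_diff: "J t \<omega> - J s \<omega> = (LINT r:{s..<t}|lborel. Y r \<omega>)"
    if "0 \<le> s" "s \<le> t" "\<omega> \<in> space M" for s t \<omega>
  proof -
    have "{0..<t} = {0..<s} \<union> {s..<t}" using that by auto
    then have "J t \<omega> = J s \<omega> + (LINT r:{s..<t}|lborel. Y r \<omega>)"
      unfolding J_def using that
      by (simp add: set_integral_Un set_integral_bounded(1)[OF Y_path(1) Y_bd])
    then show ?thesis by simp
  qed
  have J_T: "J T \<omega> = I_int X T h \<omega> - I_sum X T n h \<omega>" if \<omega>: "\<omega> \<in> space M" for \<omega>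
  proof -
    have "I_int X T h \<omega> = (LINT r:{0..T}|lborel. h (X (max 0 r) \<omega>))"
      unfolding I_int_def by (intro set_lebesgue_integral_cong) (auto simp: max_def)
    also have "\<dots> = (LINT r:{0..<T}|lborel. h (X (max 0 r) \<omega>))"
      unfolding set_lebesgue_integral_def
    proof (rule integral_cong_AE)
      show "AE r in lborel. indicator {0..T} r *\<^sub>R h (X (max 0 r) \<omega>) = indicator {0..<T} r *\<^sub>R h (X (max 0 r) \<omega>)"
        using AE_lborel_singleton[of T] by eventually_elim (auto split: split_indicator)
    qed (use Y_path(2)[OF \<omega>] in measurable)
    finally have 1: "I_int X T h \<omega> = (LINT r:{0..<T}|lborel. h (X (max 0 r) \<omega>))" .
    have step: "set_integrable lborel {0..<T} (\<lambda>r. h (X (max 0 (\<eta> r)) \<omega>))"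
      "(LINT r:{0..<T}|lborel. h (X (max 0 (\<eta> r)) \<omega>)) = \<delta> * (\<Sum>k<n. h (X (max 0 (real k * \<delta>)) \<omega>))"
      using floor_step_integral[OF \<delta>0, of n "\<lambda>r. h (X (max 0 r) \<omega>)"] by (simp_all add: \<delta>n \<eta>_def)
    have 2: "I_sum X T n h \<omega> = (LINT r:{0..<T}|lborel. h (X (max 0 (\<eta> r)) \<omega>))"
      unfolding step(2) I_sum_def using \<delta>0 by (simp add: max_absorb2 \<delta>[symmetric]) (simp add: \<delta>)
    show ?thesis
      unfolding 1 2 J_def Y_def using T
      by (intro set_integral_diff(2) step(1) set_integral_bounded(1)[OF Y_path(2)[OF \<omega>] h_bd]) auto
  qed
  have Y_ad: "Y r \<in> borel_measurable (G s)" if "0 \<le> r" "r < s" for r s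
  proof -
    have "X (max 0 r) \<in> borel_measurable (G s)" "X (max 0 (\<eta> r)) \<in> borel_measurable (G s)"
      using that \<eta>[of r] by (auto intro!: X_adapted)
    from this[THEN measurable_compose, OF h_meas] show ?thesis
      unfolding Y_def[abs_def] by (rule borel_measurable_diff)
  qed
  \<comment> \<open>A version of J s that is measurable for G s, so that functions of it are
    admissible weights in \<open>markov_diff_le\<close>.\<close>
  define J' where "J' s = real_cond_exp M (G s) (J s)" for s
  have J'_ae: "AE \<omega> in M. J' s \<omega> = J s \<omega>" if "0 \<le> s" for s
    unfolding J'_def J_def[abs_def] using that
    by (intro adapted_integral[OF Y_meas Y_bd subalgebra_G]) (auto intro: Y_ad)
  have J'_meas: "J' r \<in> borel_measurable (G s)" if "r \<le> s" for r s
    using that by (rule measurable_G_mono) (simp add: J'_def)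
  have \<Phi>_mono: "\<Phi> \<epsilon> \<le> \<Phi> T"
    using \<epsilon> by (intro DERIV_nonneg_imp_nondecreasing[of \<epsilon> T \<Phi>]) (auto intro!: \<Phi> exI)
  have L0: "L \<ge> 0"
    unfolding L using H \<epsilon> \<delta>0 B \<Phi>_mono by (intro mult_nonneg_nonneg add_nonneg_nonneg) auto

  \<comment> \<open>The weight occurs in two versions: Z is the actual one, and Z' agrees with it
    almost everywhere and belongs to the past up to s.\<close>
  have fut: "\<bar>expectation (\<lambda>\<omega>. Z \<omega> * (J t \<omega> - J s \<omega>))\<bar> \<le> L * expectation (\<lambda>\<omega>. \<bar>Z \<omega>\<bar>)"
    if Z: "integrable M Z" and Z': "Z' \<in> borel_measurable (G s)" and ZZ': "AE \<omega> in M. Z \<omega> = Z' \<omega>"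
      and st: "0 \<le> s" "s \<le> t" "t \<le> T" for Z Z' s t
  proof -
    have Z'M: "Z' \<in> borel_measurable M" by (rule measurable_from_subalg[OF subalgebra_G Z'])
    have ZM: "Z \<in> borel_measurable M" using Z by simp
    have Z'int: "integrable M Z'" using Z ZM Z'M ZZ' by (subst integrable_cong_AE[symmetric, of Z]) auto
    define e where "e = expectation (\<lambda>\<omega>. \<bar>Z \<omega>\<bar>)"
    have e0: "0 \<le> e" by (simp add: e_def)
    have e': "expectation (\<lambda>\<omega>. \<bar>Z' \<omega>\<bar>) = e"
      unfolding e_def using ZM Z'M ZZ' by (intro integral_cong_AE) auto
    \<comment> \<open>As \<eta> v > v - \<delta>, the distance from s to the grid point exceeds v -
      ?a. So \<open>w1\<close> covers the times v up to \<epsilon> past ?a, where only boundedness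
      of h is used, and \<open>w2\<close> dominates the kernel bound later. The support of
      \<open>w2\<close> may run past t, which only enlarges the bound and makes its integral
      independent of s and t.\<close>
    let ?a = "s + \<delta>"
    define w1 :: "real \<Rightarrow> real" where "w1 v = 2 * indicator {s..?a + \<epsilon>} v" for v
    define w2 :: "real \<Rightarrow> real" where "w2 v = (v - ?a) powr (- \<beta>) * indicator {?a + \<epsilon>..?a + T} v" for v
    have w1: "integrable lborel w1" "integral\<^sup>L lborel w1 = 2 * (\<epsilon> + \<delta>)"
      using \<epsilon> \<delta>0 by (auto simp: w1_def[abs_def])
    have der: "((\<lambda>v. \<Phi> (v - ?a)) has_real_derivative (v - ?a) powr (- \<beta>)) (at v)" if "v \<in> {?a + \<epsilon>..?a + T}" for v
    proof -
      have "v - ?a > 0" using that \<epsilon> by simp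
      from DERIV_chain2[where g = "\<lambda>v. v - ?a" and f = \<Phi> and Db = 1, OF \<Phi>[OF this]] show ?thesis
        by (simp add: DERIV_diff[OF DERIV_ident DERIV_const, simplified])
    qed
    have "(\<lambda>v. (v - ?a) powr (- \<beta>)) \<in> borel_measurable borel" by measurable
    from has_bochner_integral_FTC_Icc_nonneg[where a = "?a + \<epsilon>" and b = "?a + T", OF this der]
    have "has_bochner_integral lborel w2 (\<Phi> T - \<Phi> \<epsilon>)"
      using \<epsilon> by (simp add: w2_def[abs_def])
    then have w2: "integrable lborel w2" "integral\<^sup>L lborel w2 = \<Phi> T - \<Phi> \<epsilon>"
      by (auto dest: has_bochner_integral_integral_eq simp: integrable.intros)
    have pw: "\<bar>expectation (\<lambda>\<omega>. Z \<omega> * Y v \<omega>)\<bar> \<le> e * H * (w1 v + B * \<delta> * w2 v)" if v: "v \<in> {s..<t}" for v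
    proof (cases "v \<le> ?a + \<epsilon>")
      case True
      have "\<bar>expectation (\<lambda>\<omega>. Z \<omega> * Y v \<omega>)\<bar> \<le> expectation (\<lambda>\<omega>. \<bar>Z \<omega> * Y v \<omega>\<bar>)"
        by (rule integral_abs_bound)
      also have "\<dots> \<le> expectation (\<lambda>\<omega>. \<bar>Z \<omega>\<bar> * (2 * H))"
      proof (rule integral_mono)
        show "integrable M (\<lambda>\<omega>. \<bar>Z \<omega> * Y v \<omega>\<bar>)"
          by (intro integrable_abs integrable_mult_bounded[OF Z _ Y_bd]) measurable
        show "integrable M (\<lambda>\<omega>. \<bar>Z \<omega>\<bar> * (2 * H))" using Z by simp
        show "\<bar>Z \<omega> * Y v \<omega>\<bar> \<le> \<bar>Z \<omega>\<bar> * (2 * H)" for \<omega>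
          unfolding abs_mult by (intro mult_left_mono Y_bd) auto
      qed
      also have "\<dots> = e * H * w1 v" using True v by (simp add: e_def w1_def)
      also have "\<dots> \<le> e * H * (w1 v + B * \<delta> * w2 v)"
        using e0 H B \<delta>0 by (intro mult_left_mono) (auto simp: w2_def)
      finally show ?thesis .
    next
      case False
      then have v': "?a + \<epsilon> < v" "v < T" using v st by auto
      then have "0 \<le> v" using st \<delta>0 \<epsilon> by auto
      with \<eta>[of v] have \<eta>v: "0 \<le> \<eta> v" "\<eta> v \<le> v" "v - \<delta> < \<eta> v" by auto
      have "expectation (\<lambda>\<omega>. Z \<omega> * Y v \<omega>) = expectation (\<lambda>\<omega>. Z' \<omega> * (h (X v \<omega>) - h (X (\<eta> v) \<omega>)))"
      proof (rule integral_cong_AE)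
        show "AE \<omega> in M. Z \<omega> * Y v \<omega> = Z' \<omega> * (h (X v \<omega>) - h (X (\<eta> v) \<omega>))"
          using ZZ' by eventually_elim (use \<eta>v \<open>0 \<le> v\<close> in \<open>simp add: Y_def\<close>)
        show "(\<lambda>\<omega>. Z' \<omega> * (h (X v \<omega>) - h (X (\<eta> v) \<omega>))) \<in> borel_measurable M"
          using Z'M X_measurable[OF \<open>0 \<le> v\<close>] X_measurable[OF \<eta>v(1)] by measurable
      qed (use ZM in measurable)
      also have "\<bar>\<dots>\<bar> \<le> e * (H * (B * (v - \<eta> v) * (\<eta> v - s) powr (- \<beta>)))"
        unfolding e'[symmetric] using v' \<eta>v st \<epsilon> by (intro markov_diff_le[OF cX _ _ _ _ Z'int Z']) auto
      also have "\<dots> \<le> e * (H * (B * \<delta> * (v - ?a) powr (- \<beta>)))"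
        using e0 H B \<beta> v' \<eta>v \<epsilon> by (intro mult_left_mono mult_mono powr_mono2') auto
      also have "\<dots> = e * H * (B * \<delta> * w2 v)"
        using v' st \<delta>0 by (simp add: w2_def)
      also have "\<dots> \<le> e * H * (w1 v + B * \<delta> * w2 v)"
        using e0 H by (intro mult_left_mono) (auto simp: w1_def)
      finally show ?thesis .
    qed
    have w: "integrable lborel (\<lambda>v. e * H * (w1 v + B * \<delta> * w2 v))" using w1 w2 by simp
    have "expectation (\<lambda>\<omega>. Z \<omega> * (J t \<omega> - J s \<omega>)) = expectation (\<lambda>\<omega>. Z \<omega> * (LINT r:{s..<t}|lborel. Y r \<omega>))"
      using st by (intro Bochner_Integration.integral_cong) (auto simp: J_diff)
    also have "\<dots> = (LINT v:{s..<t}|lborel. expectation (\<lambda>\<omega>. Z \<omega> * Y v \<omega>))"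
      by (rule fubini_bounded(2)[OF Y_meas Y_bd Z])
    also have "\<bar>\<dots>\<bar> \<le> (\<integral>v. \<bar>indicator {s..<t} v *\<^sub>R expectation (\<lambda>\<omega>. Z \<omega> * Y v \<omega>)\<bar> \<partial>lborel)"
      unfolding set_lebesgue_integral_def by (rule integral_abs_bound)
    also have "\<dots> \<le> (\<integral>v. e * H * (w1 v + B * \<delta> * w2 v) \<partial>lborel)"
    proof (rule integral_mono[OF _ w])
      show "integrable lborel (\<lambda>v. \<bar>indicator {s..<t} v *\<^sub>R expectation (\<lambda>\<omega>. Z \<omega> * Y v \<omega>)\<bar>)"
        using fubini_bounded(1)[OF Y_meas Y_bd Z] unfolding set_integrable_def by (rule integrable_abs)
      fix v :: real
      have "0 \<le> e * H * (w1 v + B * \<delta> * w2 v)"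
        using e0 H B \<delta>0 by (auto simp: w1_def w2_def)
      then show "\<bar>indicator {s..<t} v *\<^sub>R expectation (\<lambda>\<omega>. Z \<omega> * Y v \<omega>)\<bar> \<le> e * H * (w1 v + B * \<delta> * w2 v)"
        using pw[of v] by (cases "v \<in> {s..<t}") auto
    qed
    also have "\<dots> = L * e" using w1 w2 by (simp add: L)
    finally show ?thesis by (simp add: e_def)
  qed

  have Lip: "\<bar>J t \<omega> - J s \<omega>\<bar> \<le> 2 * H * (t - s)" if "0 \<le> s" "s \<le> t" "t \<le> T" "\<omega> \<in> space M" for s t \<omega>
    unfolding J_diff[OF that(1,2,4)] by (rule set_integral_bounded(2)[OF Y_path(1)[OF that(4)] Y_bd that(2)])
  have J_bd: "\<bar>J u \<omega>\<bar> \<le> 2 * H * T" if "0 \<le> u" "u \<le> T" "\<omega> \<in> space M" for u \<omega>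
  proof -
    have "\<bar>J u \<omega>\<bar> \<le> 2 * H * u"
      using Lip[of 0 u \<omega>] that by (simp add: J_def set_lebesgue_integral_def)
    also have "\<dots> \<le> 2 * H * T" using that H by simp
    finally show ?thesis .
  qed
  have "expectation (\<lambda>\<omega>. \<bar>J T \<omega>\<bar> powr p) \<le> (p * (p - 1) * (2 * H) * L * T) powr (p / 2)"
  proof (rule moment_bound)
    show "J 0 \<omega> = 0" for \<omega> by (simp add: J_def set_lebesgue_integral_def)
    fix f :: "real \<Rightarrow> real" and r s t assume f: "mono f" and rst: "0 \<le> r" "r \<le> s" "s \<le> t" "t \<le> T"
    have [measurable]: "f \<in> borel_measurable borel" by (rule borel_measurable_mono[OF f])
    have f_bd: "f (- (2 * H * T)) \<le> f (J u \<omega>)" "f (J u \<omega>) \<le> f (2 * H * T)" if "0 \<le> u" "u \<le> T" "\<omega> \<in> space M" for u \<omega>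
      using J_bd[OF that] by (auto intro!: monoD[OF f])
    show "\<bar>expectation (\<lambda>\<omega>. (f (J s \<omega>) - f (J r \<omega>)) * (J t \<omega> - J s \<omega>))\<bar>
        \<le> L * expectation (\<lambda>\<omega>. \<bar>f (J s \<omega>) - f (J r \<omega>)\<bar>)"
    proof (rule fut)
      show "integrable M (\<lambda>\<omega>. f (J s \<omega>) - f (J r \<omega>))"
      proof (rule integrable_const_bound[where B = "f (2 * H * T) - f (- (2 * H * T))"], rule AE_I2)
        fix \<omega> assume "\<omega> \<in> space M"
        then show "norm (f (J s \<omega>) - f (J r \<omega>)) \<le> f (2 * H * T) - f (- (2 * H * T))"
          using f_bd[of s \<omega>] f_bd[of r \<omega>] rst by auto
      qed measurable
      show "(\<lambda>\<omega>. f (J' s \<omega>) - f (J' r \<omega>)) \<in> borel_measurable (G s)"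
        using J'_meas[of s s] J'_meas[of r s] rst by measurable
      show "AE \<omega> in M. f (J s \<omega>) - f (J r \<omega>) = f (J' s \<omega>) - f (J' r \<omega>)"
        using J'_ae[of s] J'_ae[of r] rst by auto
    qed (use rst in auto)
  qed (use H T p L0 Lip in auto)
  then show "expectation (\<lambda>\<omega>. \<bar>I_int X T h \<omega> - I_sum X T n h \<omega>\<bar> powr p) \<le> (p * (p - 1) * (2 * H) * L * T) powr (p / 2)"
    by (subst Bochner_Integration.integral_cong[OF refl, where g = "\<lambda>\<omega>. \<bar>J T \<omega>\<bar> powr p"]) (auto simp: J_T)
  have "integrable M (\<lambda>\<omega>. \<bar>J T \<omega>\<bar> powr r)" if "0 \<le> r"
    using J_bd[of T] T that
    by (intro integrable_const_bound[where B = "(2 * H * T) powr r"] AE_I2) (auto intro!: powr_mono2)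
  then show "0 \<le> r \<Longrightarrow> integrable M (\<lambda>\<omega>. \<bar>I_int X T h \<omega> - I_sum X T n h \<omega>\<bar> powr r)"
    by (subst Bochner_Integration.integrable_cong[OF refl, where g = "\<lambda>\<omega>. \<bar>J T \<omega>\<bar> powr r"]) (auto simp: J_T)
qed

end

text \<open>The window \<open>\<epsilon>\<close> balances its own length against \<open>T / n\<close> times the integral of
  \<open>r powr (- \<beta>)\<close> over \<open>[\<epsilon>, T]\<close>: it is \<open>T / n\<close> for \<open>\<beta> = 1\<close> and \<open>T * n powr (- 1 / \<beta>)\<close>
  for \<open>\<beta> > 1\<close>. The case \<open>\<beta> = 1\<close>, \<open>n = 2\<close> is nearly tight and rests on \<open>2 / 3 \<le> ln 2\<close>.\<close>

lemma D_const_bound: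
  assumes T: "T > 0" and n: "n \<ge> 1" and B: "B \<ge> 1" and \<beta>: "\<beta> \<ge> 1" and not1: "\<not> (\<beta> = 1 \<and> n = 1)"
  obtains \<epsilon> \<Phi> where "0 < \<epsilon>" "\<epsilon> \<le> T"
    "\<And>r. r > 0 \<Longrightarrow> (\<Phi> has_real_derivative r powr (- \<beta>)) (at r)"
    "2 * (\<epsilon> + T / real n) + B * (T / real n) * (\<Phi> T - \<Phi> \<epsilon>) \<le> 7 * B * T * D_const T \<beta> n"
proof (cases "\<beta> = 1")
  case True
  with not1 n have n2: "real n \<ge> 2" by (cases n) auto
  have "ln 2 \<le> ln (real n)" using n2 by simp
  with ln2_ge_two_thirds have ln: "2 / 3 \<le> ln (real n)" by linarith
  show thesis
  proof (rule that[of "T / real n" ln])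
    show "(ln has_real_derivative r powr (- \<beta>)) (at r)" if "r > 0" for r
      using DERIV_ln[OF that] True that by (simp add: powr_minus)
    \<comment> \<open>Origin of the constant 7: six copies of B ln n pay for the window term 4,
      which is exact at ln n = 2/3 and B = 1, and the seventh is the integral of 1/r over
      [T/n, T].\<close>
    have "4 * 1 \<le> 6 * (B * ln (real n))"
      using mult_mono[of 1 B "2 / 3" "ln (real n)"] B ln by simp
    then have "T / real n * (4 + B * ln (real n)) \<le> T / real n * (7 * (B * ln (real n)))"
      using T by (intro mult_left_mono) auto
    then show "2 * (T / real n + T / real n) + B * (T / real n) * (ln T - ln (T / real n)) \<le> 7 * B * T * D_const T \<beta> n"
      using T n2 True by (simp add: D_const_def ln_div algebra_simps)
    show "T / real n \<le> T" using T n2 by (simp add: divide_le_eq)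
  qed (use T n2 in auto)
next
  case False
  with \<beta> have \<beta>1: "\<beta> > 1" by simp
  have n0: "real n \<ge> 1" using n by simp
  define m where "m = real n powr (- 1 / \<beta>)"
  define K where "K = max 1 (T powr (1 - \<beta>) / (\<beta> - 1))"
  have D: "D_const T \<beta> n = K * m" using False by (simp add: D_const_def K_def m_def)
  have m: "0 < m" "m \<le> 1" using n0 \<beta>1 powr_mono[of "- 1 / \<beta>" 0 "real n"] by (auto simp: m_def)
  have inv_n: "1 / real n \<le> m"
  proof -
    have "real n powr (- 1) \<le> real n powr (- 1 / \<beta>)"
      using n0 \<beta>1 by (intro powr_mono) (auto simp: field_simps)
    then show ?thesis using n0 by (simp add: m_def powr_minus_divide)
  qed
  show thesis
  proof (rule that[of "T * m" "\<lambda>r. r powr (1 - \<beta>) / (1 - \<beta>)"])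
    show "((\<lambda>r. r powr (1 - \<beta>) / (1 - \<beta>)) has_real_derivative r powr (- \<beta>)) (at r)" if "r > 0" for r
      using DERIV_cdivide[OF has_real_derivative_powr[OF that, of "1 - \<beta>"], of "1 - \<beta>"] \<beta>1 by simp
    \<comment> \<open>The balance that fixes the exponent: m^(1-\<beta>) / n = m means m^\<beta> =
      1/n.\<close>
    have mp: "m powr (1 - \<beta>) / real n = m"
    proof -
      have "m powr (1 - \<beta>) = real n powr (- 1 / \<beta> * (1 - \<beta>))" by (simp add: m_def powr_powr)
      also have "- 1 / \<beta> * (1 - \<beta>) = - 1 / \<beta> + 1" using \<beta>1 by (simp add: field_simps)
      also have "real n powr (- 1 / \<beta> + 1) = m * real n" using n0 unfolding powr_add m_def by simp
      finally show ?thesis using n0 by simp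
    qed
    have "B * (T / real n) * (T powr (1 - \<beta>) / (1 - \<beta>) - (T * m) powr (1 - \<beta>) / (1 - \<beta>))
        \<le> B * (T / real n) * ((T * m) powr (1 - \<beta>) / (\<beta> - 1))"
    proof (intro mult_left_mono)
      have "T powr (1 - \<beta>) / (1 - \<beta>) \<le> 0" using \<beta>1 by (simp add: divide_le_0_iff)
      moreover have "(T * m) powr (1 - \<beta>) / (\<beta> - 1) = - ((T * m) powr (1 - \<beta>) / (1 - \<beta>))"
        by (metis minus_diff_eq minus_divide_right)
      ultimately show "T powr (1 - \<beta>) / (1 - \<beta>) - (T * m) powr (1 - \<beta>) / (1 - \<beta>) \<le> (T * m) powr (1 - \<beta>) / (\<beta> - 1)"
        by linarith
    qed (use B T in auto)
    also have "\<dots> = B * T * (T powr (1 - \<beta>) / (\<beta> - 1)) * (m powr (1 - \<beta>) / real n)"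
      using T m by (simp add: powr_mult mult_ac)
    also have "\<dots> \<le> B * T * K * m"
      unfolding mp using B T m by (intro mult_right_mono mult_left_mono) (auto simp: K_def)
    finally have 1: "B * (T / real n) * (T powr (1 - \<beta>) / (1 - \<beta>) - (T * m) powr (1 - \<beta>) / (1 - \<beta>)) \<le> B * T * K * m" .
    have "T * (1 / real n) \<le> T * m" using inv_n T by (intro mult_left_mono) auto
    then have "2 * (T * m + T / real n) \<le> 4 * (1 * (T * m))" by simp
    also have "\<dots> \<le> 4 * (B * K * (T * m))"
    proof (intro mult_left_mono mult_right_mono)
      \<comment> \<open>The lower bound 1 inside the maximum of \<open>D_const\<close> lets the
        window be absorbed. The total here is 4 + 1 = 5 copies, below the 7 that \<beta> = 1
        dictates.\<close>
      have "1 * 1 \<le> B * K" using B by (intro mult_mono) (auto simp: K_def)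
      then show "1 \<le> B * K" by simp
    qed (use T m in auto)
    finally have "2 * (T * m + T / real n) \<le> 4 * (B * T * K * m)" by (simp add: mult_ac)
    moreover have "0 \<le> B * T * K * m" using B T m by (simp add: K_def)
    moreover have "7 * B * T * D_const T \<beta> n = 7 * (B * T * K * m)" by (simp add: D)
    ultimately show "2 * (T * m + T / real n)
        + B * (T / real n) * (T powr (1 - \<beta>) / (1 - \<beta>) - (T * m) powr (1 - \<beta>) / (1 - \<beta>)) \<le> 7 * B * T * D_const T \<beta> n"
      using 1 by linarith
    show "T * m \<le> T" using m T by simp
  qed (use T m in auto)
qed

section \<open>Choice of the window, and passage to all exponents p > 0\<close>

theorem theorem2p1:
  fixes F :: "'w measure"
    and Pr :: "real ^ 'd::finite \<Rightarrow> 'w measure"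
    and X :: "real \<Rightarrow> 'w \<Rightarrow> real ^ 'd"
    and P :: "real \<Rightarrow> real ^ 'd \<Rightarrow> (real ^ 'd) measure"
    and q :: "real \<Rightarrow> real ^ 'd \<Rightarrow> real ^ 'd \<Rightarrow> real"
    and h :: "real ^ 'd \<Rightarrow> real"
    and x :: "real ^ 'd"
    and T B \<beta> p :: real
    and n :: nat
  assumes "markov_process F Pr X P"
    and "T > 0"
    and "condition_X T P B \<beta> q"
    and "p > 0"
    and "h \<in> borel_measurable borel" and "bounded (range h)"
    and "n \<ge> 1" and "\<not> (\<beta> = 1 \<and> n = 1)"
  shows "(\<integral>\<omega>. \<bar>I_int X T h \<omega> - I_sum X T n h \<omega>\<bar> powr p \<partial>Pr x) powr (1 / p)
         \<le> C_const T B p * sup_norm h * sqrt (D_const T \<beta> n)"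
proof -
  define H where "H = sup_norm h"
  have h_bd: "\<bar>h y\<bar> \<le> H" for y
  proof -
    obtain C where "\<And>y. \<bar>h y\<bar> \<le> C" using assms(6) by (auto simp: bounded_iff)
    then show ?thesis unfolding H_def sup_norm_def by (intro cSUP_upper bdd_aboveI[of _ C]) auto
  qed
  have H0: "0 \<le> H" using h_bd[of undefined] by linarith
  have M: "prob_space (Pr x)" "sets (Pr x) = sets F" "transition_function P"
    "(\<lambda>(t, \<omega>). X t \<omega>) \<in> borel_measurable (restrict_space borel {0..} \<Otimes>\<^sub>M F)"
    and markov: "\<And>s t A. 0 \<le> s \<Longrightarrow> 0 \<le> t \<Longrightarrow> A \<in> sets borel \<Longrightarrow> AE \<omega> in Pr x.
      real_cond_exp (Pr x) (natural_filtration (Pr x) X s) (\<lambda>\<omega>. indicator A (X (s + t) \<omega>)) \<omega> = measure (P t (X s \<omega>)) A"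
    using assms(1) unfolding markov_process_def by blast+
  interpret prob_space "Pr x" by (rule M)
  have X_meas: "(\<lambda>(t, \<omega>). X t \<omega>) \<in> borel_measurable (restrict_space borel {0..} \<Otimes>\<^sub>M Pr x)"
    using M(4) measurable_cong_sets[OF sets_pair_measure_cong[OF refl M(2)] refl] by blast
  interpret markov_law "Pr x" X P h H
    by standard (fact X_meas M(3) assms(5) h_bd | rule markov; assumption)+
  show ?thesis
  \<comment> \<open>The moment bound asks for a positive Lipschitz constant 2 H; for H = 0 the
    function h vanishes and so do both sides.\<close>
  proof (cases "H = 0")
    case True
    then have "h y = 0" for y using h_bd[of y] by simp
    then show ?thesis
      using True by (simp add: I_int_def I_sum_def set_lebesgue_integral_def flip: H_def)
  next
    case False
    with H0 have H: "H > 0" by simp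
    have B: "B \<ge> 1" and \<beta>: "\<beta> \<ge> 1" using assms(3) by (auto simp: condition_X_def)
    obtain \<epsilon> \<Phi> where \<epsilon>: "0 < \<epsilon>" "\<epsilon> \<le> T"
      and \<Phi>: "\<And>r. r > 0 \<Longrightarrow> (\<Phi> has_real_derivative r powr (- \<beta>)) (at r)"
      and le: "2 * (\<epsilon> + T / real n) + B * (T / real n) * (\<Phi> T - \<Phi> \<epsilon>) \<le> 7 * B * T * D_const T \<beta> n"
      using D_const_bound[OF assms(2,7) B \<beta> assms(8)] by metis
    define D where "D = D_const T \<beta> n"
    have D0: "D \<ge> 0" using assms(7) by (auto simp: D_def D_const_def)
    define L where "L = H * (2 * (\<epsilon> + T / real n) + B * (T / real n) * (\<Phi> T - \<Phi> \<epsilon>))"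
    have L: "L \<le> H * (7 * B * T * D)" unfolding L_def D_def using le H by (intro mult_left_mono) auto
    have L0: "L \<ge> 0"
    proof -
      have "\<Phi> \<epsilon> \<le> \<Phi> T"
        using \<epsilon> by (intro DERIV_nonneg_imp_nondecreasing[of \<epsilon> T \<Phi>]) (auto intro!: \<Phi> exI)
      then show ?thesis using H \<epsilon> B assms(2) by (simp add: L_def)
    qed
    let ?V = "\<lambda>\<omega>. \<bar>I_int X T h \<omega> - I_sum X T n h \<omega>\<bar>"
    have n0: "n > 0" using assms(7) by simp
    have moment: "expectation (\<lambda>\<omega>. ?V \<omega> powr r) \<le> (14 * r * (r - 1) * B * (T * H)\<^sup>2 * D) powr (r / 2)"
      if r: "r \<ge> 2" for r
    proof -
      have "expectation (\<lambda>\<omega>. ?V \<omega> powr r) \<le> (r * (r - 1) * (2 * H) * L * T) powr (r / 2)"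
        by (rule riemann_sum_moment(1)[OF assms(3,2) n0 r H refl \<epsilon> \<Phi> L_def])
      also have "\<dots> \<le> (r * (r - 1) * (2 * H) * (H * (7 * B * T * D)) * T) powr (r / 2)"
        using r H L L0 assms(2) by (intro powr_mono2 mult_right_mono mult_left_mono) auto
      \<comment> \<open>The constant 14 is the product of 2 from the Lipschitz constant and 7 from
        the window.\<close>
      also have "r * (r - 1) * (2 * H) * (H * (7 * B * T * D)) * T = 14 * r * (r - 1) * B * (T * H)\<^sup>2 * D"
        by (simp add: power2_eq_square)
      finally show ?thesis .
    qed
    have int: "integrable (Pr x) (\<lambda>\<omega>. ?V \<omega> powr r)" if "r \<ge> 0" for r
      by (rule riemann_sum_moment(2)[OF assms(3,2) n0 order.refl H refl \<epsilon> \<Phi> L_def that])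
    have root: "(14 * r * (r - 1) * B * (T * H)\<^sup>2 * D) powr (1 / 2) = sqrt (14 * r * (r - 1) * B) * T * H * sqrt D"
      if "r \<ge> 2" for r
      using that B H assms(2) D0 by (simp add: powr_half_sqrt real_sqrt_mult)
    have "expectation (\<lambda>\<omega>. ?V \<omega> powr p) \<le> (C_const T B p * H * sqrt D) powr p"
    proof (cases "p \<ge> 2")
      case True
      have "expectation (\<lambda>\<omega>. ?V \<omega> powr p) \<le> (14 * p * (p - 1) * B * (T * H)\<^sup>2 * D) powr (1 / 2 * p)"
        using moment[OF True] by simp
      also have "\<dots> = (C_const T B p * H * sqrt D) powr p"
        unfolding powr_powr[symmetric] root[OF True] using True by (simp add: C_const_def)
      finally show ?thesis .
    next
      case False
      \<comment> \<open>For p < 2 Jensen is applied to the square with exponent p/2; at r = 2 the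
        factor 14 r (r - 1) becomes 28.\<close>
      have Vp: "(?V \<omega> powr 2) powr (p / 2) = ?V \<omega> powr p" for \<omega>
        unfolding powr_powr by simp
      have "expectation (\<lambda>\<omega>. ?V \<omega> powr p) = expectation (\<lambda>\<omega>. (?V \<omega> powr 2) powr (p / 2))"
        unfolding Vp ..
      also have "\<dots> \<le> expectation (\<lambda>\<omega>. ?V \<omega> powr 2) powr (p / 2)"
      proof (rule expectation_powr_le)
        show "integrable (Pr x) (\<lambda>\<omega>. (?V \<omega> powr 2) powr (p / 2))"
          unfolding Vp using assms(4) by (intro int) simp
        show "integrable (Pr x) (\<lambda>\<omega>. ?V \<omega> powr 2)" by (rule int) simp
      qed (use assms(4) False in auto)
      also have "\<dots> \<le> ((14 * 2 * (2 - 1) * B * (T * H)\<^sup>2 * D) powr (2 / 2)) powr (p / 2)"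
        using assms(4) by (intro powr_mono2 moment) auto
      also have "\<dots> = (14 * 2 * (2 - 1) * B * (T * H)\<^sup>2 * D) powr (1 / 2 * p)"
        unfolding powr_powr by simp
      also have "\<dots> = (C_const T B p * H * sqrt D) powr p"
        unfolding powr_powr[symmetric] root[OF order.refl] using False by (simp add: C_const_def)
      finally show ?thesis .
    qed
    then have "expectation (\<lambda>\<omega>. ?V \<omega> powr p) powr (1 / p) \<le> ((C_const T B p * H * sqrt D) powr p) powr (1 / p)"
      using assms(4) by (intro powr_mono2) auto
    also have "\<dots> = C_const T B p * H * sqrt D"
      using assms(2,4) B H D0 by (auto simp: powr_powr C_const_def)
    finally show ?thesis by (simp add: H_def D_def)
  qed
qed

end
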